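(* Let $k$ be an algebraically closed field of characteristic zero and let $n \geq 2$ be an integer. The Yang-Mills algebra $\mathrm{YM}(n)$ is noetherian if and only if $n = 2$.
   Context: For an integer $n \geq 2$, let $\mathfrak{f}(n)$ be the free Lie algebra over $k$ on generators $x_1,\dots,x_n$. The Lie Yang-Mills algebra is the quotient $\mathfrak{ym}(n) = \mathfrak{f}(n)/\langle \sum_{i=1}^n [x_i,[x_i,x_j]] : 1 \leq j \leq n\rangle$ by the Lie ideal generated by the indicated elements, and $\mathrm{YM}(n) = \mathcal{U}(\mathfrak{ym}(n))$ is its universal enveloping algebra. *)

theory Defs
  imports
    "HOL-Library.Poly_Mapping"
    "HOL-Computational_Algebra.Polynomial"
    "HOL-Algebra.QuotRing"
    "HOL-Algebra.Module"
begin

section \<open>Algebras over a field and their quotients\<close>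

text \<open>
  The field of scalars is a type \<^typ>\<open>'k\<close>. An algebra over it (associative or not) is a record
  of type \<^typ>\<open>('k, 'a) module\<close>, whose field \<^const>\<open>mult\<close> holds the product. For Lie algebras
  this is the bracket, the ideals below are the Lie ideals, and the field \<^const>\<open>one\<close> is
  meaningless.
\<close>

definition alg_ideal :: "'a set \<Rightarrow> ('k, 'a) module \<Rightarrow> bool" where
  "alg_ideal I A \<longleftrightarrow> additive_subgroup I A \<and>
     (\<forall>c. \<forall>a\<in>I. c \<odot>\<^bsub>A\<^esub> a \<in> I) \<and>
     (\<forall>x\<in>carrier A. \<forall>a\<in>I. x \<otimes>\<^bsub>A\<^esub> a \<in> I \<and> a \<otimes>\<^bsub>A\<^esub> x \<in> I)"

definition gen_alg_ideal :: "('k, 'a) module \<Rightarrow> 'a set \<Rightarrow> 'a set" where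
  "gen_alg_ideal A S = \<Inter>{I. alg_ideal I A \<and> S \<subseteq> I}"

definition alg_quot :: "('k, 'a) module \<Rightarrow> 'a set \<Rightarrow> ('k, 'a set) module" where
  "alg_quot A I =
     \<lparr>carrier = a_rcosets\<^bsub>A\<^esub> I, mult = rcoset_mult A I, one = I +>\<^bsub>A\<^esub> \<one>\<^bsub>A\<^esub>,
      zero = I, add = set_add A, smult = (\<lambda>c X. \<Union>x\<in>X. I +>\<^bsub>A\<^esub> (c \<odot>\<^bsub>A\<^esub> x))\<rparr>"


section \<open>Free algebras\<close>

text \<open>
  Finitely supported functions on a set \<open>B\<close> with a binary operation \<open>f\<close>, multiplied by extending
  \<open>f\<close> bilinearly. The parameter \<open>u\<close> is the unit, where there is one.
\<close>

definition bilinear_ext ::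
    "('b \<Rightarrow> 'b \<Rightarrow> 'b) \<Rightarrow> ('b \<Rightarrow>\<^sub>0 'k) \<Rightarrow> ('b \<Rightarrow>\<^sub>0 'k) \<Rightarrow> ('b \<Rightarrow>\<^sub>0 'k::field)" where
  "bilinear_ext f p q = (\<Sum>s\<in>Poly_Mapping.keys p. \<Sum>t\<in>Poly_Mapping.keys q.
     Poly_Mapping.single (f s t) (Poly_Mapping.lookup p s * Poly_Mapping.lookup q t))"

definition magma_algebra ::
    "'b set \<Rightarrow> ('b \<Rightarrow> 'b \<Rightarrow> 'b) \<Rightarrow> ('b \<Rightarrow>\<^sub>0 'k) \<Rightarrow> ('k::field, 'b \<Rightarrow>\<^sub>0 'k) module" where
  "magma_algebra B f u =
     \<lparr>carrier = {p. Poly_Mapping.keys p \<subseteq> B}, mult = bilinear_ext f, one = u,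
      zero = 0, add = (+), smult = (\<lambda>c. Poly_Mapping.map ((*) c))\<rparr>"

datatype 'x magma = Gen 'x | Br "'x magma" "'x magma"

definition free_na_algebra :: "'x set \<Rightarrow> ('k::field, 'x magma \<Rightarrow>\<^sub>0 'k) module" where
  "free_na_algebra X = magma_algebra {t. set_magma t \<subseteq> X} Br 0"

definition free_assoc_algebra :: "'x set \<Rightarrow> ('k::field, 'x list \<Rightarrow>\<^sub>0 'k) module" where
  "free_assoc_algebra X = magma_algebra (lists X) (@) (Poly_Mapping.single [] 1)"


section \<open>Free Lie algebras\<close>

definition lie_axiom_elements :: "('k, 'a) module \<Rightarrow> 'a set" where
  "lie_axiom_elements A =
     {x \<otimes>\<^bsub>A\<^esub> x | x. x \<in> carrier A} \<union>
     {x \<otimes>\<^bsub>A\<^esub> (y \<otimes>\<^bsub>A\<^esub> z) \<oplus>\<^bsub>A\<^esub> y \<otimes>\<^bsub>A\<^esub> (z \<otimes>\<^bsub>A\<^esub> x) \<oplus>\<^bsub>A\<^esub> z \<otimes>\<^bsub>A\<^esub> (x \<otimes>\<^bsub>A\<^esub> y)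
       | x y z. x \<in> carrier A \<and> y \<in> carrier A \<and> z \<in> carrier A}"

definition free_lie_ideal :: "'x set \<Rightarrow> ('x magma \<Rightarrow>\<^sub>0 'k::field) set" where
  "free_lie_ideal X = gen_alg_ideal (free_na_algebra X) (lie_axiom_elements (free_na_algebra X))"

definition free_lie :: "'x set \<Rightarrow> ('k::field, ('x magma \<Rightarrow>\<^sub>0 'k) set) module" where
  "free_lie X = alg_quot (free_na_algebra X) (free_lie_ideal X)"

definition free_lie_gen :: "'x set \<Rightarrow> 'x \<Rightarrow> ('x magma \<Rightarrow>\<^sub>0 'k::field) set" where
  "free_lie_gen X i = free_lie_ideal X +>\<^bsub>free_na_algebra X\<^esub> Poly_Mapping.single (Gen i) 1"


section \<open>The universal enveloping algebra\<close>

text \<open>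
  The quotient of the tensor algebra by the elements \<open>x \<otimes> y - y \<otimes> x - [x, y]\<close>. The tensor algebra
  of a Lie algebra is itself presented as the free associative algebra on the underlying set modulo
  the linear relations (the first two families below), and both quotients are taken at once.
\<close>

definition enveloping_relations :: "('k::field, 'a) module \<Rightarrow> ('a list \<Rightarrow>\<^sub>0 'k) set" where
  "enveloping_relations L = (let \<iota> = (\<lambda>x. Poly_Mapping.single [x] 1) in
     {\<iota> (x \<oplus>\<^bsub>L\<^esub> y) - \<iota> x - \<iota> y | x y. x \<in> carrier L \<and> y \<in> carrier L} \<union>
     {\<iota> (c \<odot>\<^bsub>L\<^esub> x) - Poly_Mapping.single [x] c | c x. x \<in> carrier L} \<union>
     {Poly_Mapping.single [x, y] 1 - Poly_Mapping.single [y, x] 1 - \<iota> (x \<otimes>\<^bsub>L\<^esub> y)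
       | x y. x \<in> carrier L \<and> y \<in> carrier L})"

definition universal_enveloping ::
    "('k::field, 'a) module \<Rightarrow> ('k, ('a list \<Rightarrow>\<^sub>0 'k) set) module" where
  "universal_enveloping L =
     alg_quot (free_assoc_algebra (carrier L))
       (gen_alg_ideal (free_assoc_algebra (carrier L)) (enveloping_relations L))"


section \<open>Yang--Mills algebras\<close>

definition ym_relations :: "nat \<Rightarrow> (nat magma \<Rightarrow>\<^sub>0 'k::field) set set" where
  "ym_relations n = (let L = free_lie {1..n}; x = free_lie_gen {1..n} in
     {finsum L (\<lambda>i. x i \<otimes>\<^bsub>L\<^esub> (x i \<otimes>\<^bsub>L\<^esub> x j)) {1..n} | j. j \<in> {1..n}})"

definition lie_yang_mills ::
    "'k::field itself \<Rightarrow> nat \<Rightarrow> ('k, (nat magma \<Rightarrow>\<^sub>0 'k) set set) module" where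
  "lie_yang_mills k n =
     alg_quot (free_lie {1..n}) (gen_alg_ideal (free_lie {1..n}) (ym_relations n))"

definition yang_mills ::
    "'k::field itself \<Rightarrow> nat \<Rightarrow> ('k, ((nat magma \<Rightarrow>\<^sub>0 'k) set set list \<Rightarrow>\<^sub>0 'k) set) module" where
  "yang_mills k n = universal_enveloping (lie_yang_mills k n)"


section \<open>Noetherian rings\<close>

text \<open>
  The library locale \<open>noetherian_ring\<close> only constrains two-sided ideals, which is too weak for
  noncommutative rings.
\<close>

definition left_ideal :: "'a set \<Rightarrow> ('a, 'b) ring_scheme \<Rightarrow> bool" where
  "left_ideal I R \<longleftrightarrow> additive_subgroup I R \<and> (\<forall>r\<in>carrier R. \<forall>a\<in>I. r \<otimes>\<^bsub>R\<^esub> a \<in> I)"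

definition right_ideal :: "'a set \<Rightarrow> ('a, 'b) ring_scheme \<Rightarrow> bool" where
  "right_ideal I R \<longleftrightarrow> additive_subgroup I R \<and> (\<forall>r\<in>carrier R. \<forall>a\<in>I. a \<otimes>\<^bsub>R\<^esub> r \<in> I)"

definition left_noetherian :: "('a, 'b) ring_scheme \<Rightarrow> bool" where
  "left_noetherian R \<longleftrightarrow> ring R \<and>
     (\<forall>I. left_ideal I R \<longrightarrow>
       (\<exists>S. finite S \<and> S \<subseteq> carrier R \<and> I = \<Inter>{J. left_ideal J R \<and> S \<subseteq> J}))"

definition right_noetherian :: "('a, 'b) ring_scheme \<Rightarrow> bool" where
  "right_noetherian R \<longleftrightarrow> ring R \<and>
     (\<forall>I. right_ideal I R \<longrightarrow>
       (\<exists>S. finite S \<and> S \<subseteq> carrier R \<and> I = \<Inter>{J. right_ideal J R \<and> S \<subseteq> J}))"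

definition noetherian :: "('a, 'b) ring_scheme \<Rightarrow> bool" where
  "noetherian R \<longleftrightarrow> left_noetherian R \<and> right_noetherian R"

end

theory Submission
  imports Defs "HOL-Algebra.Subrings" "HOL-Library.Product_Plus"
begin

text \<open>
  For \<open>n = 2\<close> the relations say that \<open>z = [x\<^sub>1, x\<^sub>2]\<close> commutes with \<open>x\<^sub>1\<close> and \<open>x\<^sub>2\<close>, so the algebra is
  the enveloping algebra of the Heisenberg Lie algebra. It is reached from the scalars by adjoining
  \<open>z\<close>, then \<open>x\<^sub>2\<close>, then \<open>x\<^sub>1\<close>, and at each step the commutator of the new element with the old
  subring stays in the old subring. Hilbert's basis argument works for such a step, because moving
  the new element past a coefficient changes a polynomial only in lower degrees
  (\<open>fg_submods_polys\<close>). The hypotheses are symmetric under reversal of the product, which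
  gives the right-hand version (\<open>heisenberg_noetherian\<close>).
  
  For \<open>n \<ge> 3\<close> there are many representations. Let \<open>i\<^sup>2 = -1\<close> and send \<open>x\<^sub>1, x\<^sub>2, x\<^sub>3\<close> to \<open>a, i a, b\<close> and
  the other generators to \<open>0\<close>. The contributions of \<open>x\<^sub>1\<close> and \<open>x\<^sub>2\<close> to each relation cancel and what
  remains is \<open>[b, [b, a]] = 0\<close>. This holds for the upper triangular matrices \<open>a = y E\<^sub>2\<^sub>2\<close> and
  \<open>b = E\<^sub>1\<^sub>2\<close>. In the ring of matrices with upper left entry in \<open>k\<close> and other entries in \<open>k[y]\<close>, the
  strictly upper triangular matrices form a left ideal on which the ring acts through \<open>k\<close> alone; it
  contains all \<open>b a\<^sup>m = y\<^sup>m E\<^sub>1\<^sub>2\<close>, so it is infinite-dimensional over \<open>k\<close> and its preimage in the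
  Yang-Mills algebra is not finitely generated (\<open>not_left_noetherian_if_tri_map\<close>).
  
  The algebra is built from a free nonassociative algebra by three successive quotients and a
  passage to words. What links this to the arguments above is the universal property of each stage,
  which comes from \<open>algebra_map_factor\<close>: the kernel of a homomorphism is an ideal, so a homomorphism
  that kills the generators of an ideal descends to the quotient.
\<close>

section \<open>Finitely generated left submodules\<close>

context ring begin

definition left_submod :: "'a set \<Rightarrow> 'a set \<Rightarrow> bool" where
  "left_submod S J \<longleftrightarrow> additive_subgroup J R \<and> (\<forall>s\<in>S. \<forall>v\<in>J. s \<otimes> v \<in> J)"

text \<open>
  The left span is generated by adding one multiple at a time, so that statements about linear
  combinations become inductions without finite sums.
\<close>

inductive_set lspan :: "'a set \<Rightarrow> 'a set \<Rightarrow> 'a set" for S F where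
  zero: "\<zero> \<in> lspan S F"
| add: "s \<in> S \<Longrightarrow> f \<in> F \<Longrightarrow> v \<in> lspan S F \<Longrightarrow> s \<otimes> f \<oplus> v \<in> lspan S F"

text \<open>
  Left noetherianity of the subring \<open>S\<close>, phrased inside the ambient ring so that a tower of
  subrings can be treated without changing the ring.
\<close>

definition fg_submods :: "'a set \<Rightarrow> bool" where
  "fg_submods S \<longleftrightarrow>
     (\<forall>J. left_submod S J \<and> J \<subseteq> S \<longrightarrow> (\<exists>F. finite F \<and> F \<subseteq> J \<and> J \<subseteq> lspan S F))"

lemma left_submodD:
  assumes "left_submod S J"
  shows "J \<subseteq> carrier R" "\<zero> \<in> J" "u \<in> J \<Longrightarrow> v \<in> J \<Longrightarrow> u \<oplus> v \<in> J" "u \<in> J \<Longrightarrow> \<ominus> u \<in> J"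
    "s \<in> S \<Longrightarrow> u \<in> J \<Longrightarrow> s \<otimes> u \<in> J"
proof -
  interpret J: additive_subgroup J R using assms by (simp add: left_submod_def)
  show "J \<subseteq> carrier R" "\<zero> \<in> J" "u \<in> J \<Longrightarrow> v \<in> J \<Longrightarrow> u \<oplus> v \<in> J" "u \<in> J \<Longrightarrow> \<ominus> u \<in> J"
    using J.a_subset by auto
  show "s \<in> S \<Longrightarrow> u \<in> J \<Longrightarrow> s \<otimes> u \<in> J" using assms by (simp add: left_submod_def)
qed

lemma additive_subgroup_carrierI:
  assumes "J \<subseteq> carrier R" "\<zero> \<in> J" "\<And>u v. u \<in> J \<Longrightarrow> v \<in> J \<Longrightarrow> u \<oplus> v \<in> J" "\<And>u. u \<in> J \<Longrightarrow> \<ominus> u \<in> J"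
  shows "additive_subgroup J R"
  using assms by (intro additive_subgroupI add.subgroupI) auto

lemma lspan_mono: "F \<subseteq> G \<Longrightarrow> v \<in> lspan S F \<Longrightarrow> v \<in> lspan S G"
  by (rotate_tac, induction rule: lspan.induct) (auto intro: lspan.intros)

lemma lspan_least:
  assumes "left_submod S J" "F \<subseteq> J" shows "lspan S F \<subseteq> J"
proof
  fix v assume "v \<in> lspan S F"
  then show "v \<in> J" by induction (use assms left_submodD[OF assms(1)] in auto)
qed

lemma
  assumes S: "subring S R" and F: "F \<subseteq> carrier R"
  shows left_submod_lspan: "left_submod S (lspan S F)"
    and lspan_superset: "F \<subseteq> lspan S F"
proof -
  note SD = subringE[OF S]
  have car: "v \<in> carrier R" if "v \<in> lspan S F" for v
    using that by induction (use SD(1) F in auto)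
  have sum: "u \<oplus> v \<in> lspan S F" if u: "u \<in> lspan S F" and v: "v \<in> lspan S F" for u v
    using u
  proof induction
    case zero then show ?case using v car by simp
  next
    case (add s f w)
    then have "s \<otimes> f \<oplus> w \<oplus> v = s \<otimes> f \<oplus> (w \<oplus> v)"
      using SD(1) F v car by (intro a_assoc) auto
    then show ?case using add by (auto intro: lspan.intros)
  qed
  have scal: "r \<otimes> u \<in> lspan S F" if r: "r \<in> S" and u: "u \<in> lspan S F" for r u
    using u
  proof induction
    case zero then show ?case using r SD(1) by (auto intro: lspan.intros simp: subset_iff)
  next
    case (add s f w)
    then have "r \<otimes> (s \<otimes> f \<oplus> w) = (r \<otimes> s) \<otimes> f \<oplus> r \<otimes> w"
      using SD(1) F car r by (subst r_distr) (auto simp: m_assoc subset_iff)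
    then show ?case using add SD(6) r by (auto intro: lspan.intros)
  qed
  have neg: "\<ominus> u \<in> lspan S F" if u: "u \<in> lspan S F" for u
    using scal[of "\<ominus> \<one>" u] SD(3,5) u car by (simp add: l_minus)
  show "left_submod S (lspan S F)" unfolding left_submod_def
    by (intro conjI additive_subgroup_carrierI ballI) (auto intro: car sum scal neg lspan.zero)
  show "F \<subseteq> lspan S F"
  proof
    fix f assume f: "f \<in> F"
    then have "\<one> \<otimes> f \<oplus> \<zero> \<in> lspan S F" using SD(3) by (intro lspan.intros)
    then show "f \<in> lspan S F" using f F by auto
  qed
qed

text \<open>
  The ascending chain condition for sequences of elements: the union of the spans of the initial
  segments is finitely generated, hence equal to one of the spans. Leading coefficients enter the
  basis theorem in this form.
\<close>

lemma fg_submods_sequence: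
  fixes s :: "nat \<Rightarrow> 'a"
  assumes S: "subring S R" and fg: "fg_submods S" and s: "range s \<subseteq> S"
  obtains N where "s N \<in> lspan S (s ` {..<N})"
proof -
  note SD = subringE[OF S]
  have sc: "s ` A \<subseteq> carrier R" for A using s SD(1) by auto
  define J where "J = (\<Union>N. lspan S (s ` {..<N}))"
  note sub = left_submodD[OF left_submod_lspan[OF S sc]]
  have J: "left_submod S J" unfolding left_submod_def
  proof (intro conjI additive_subgroup_carrierI ballI)
    show "J \<subseteq> carrier R" using sub(1) by (auto simp: J_def)
    show "\<zero> \<in> J" using sub(2) by (auto simp: J_def)
    show "\<ominus> u \<in> J" if "u \<in> J" for u using sub(4) that by (auto simp: J_def)
    show "r \<otimes> u \<in> J" if "r \<in> S" "u \<in> J" for r u using sub(5) that by (auto simp: J_def)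
    fix u v assume "u \<in> J" "v \<in> J"
    then obtain M N where "u \<in> lspan S (s ` {..<M})" "v \<in> lspan S (s ` {..<N})"
      by (auto simp: J_def)
    then have "u \<in> lspan S (s ` {..<max M N})" "v \<in> lspan S (s ` {..<max M N})"
      by (auto intro: lspan_mono[OF image_mono, rotated])
    then show "u \<oplus> v \<in> J" using sub(3) by (auto simp: J_def)
  qed
  have "left_submod S S" unfolding left_submod_def
    by (intro conjI additive_subgroup_carrierI ballI) (use SD in auto)
  then have "lspan S (s ` {..<N}) \<subseteq> S" for N by (rule lspan_least) (use s in auto)
  then have "J \<subseteq> S" unfolding J_def by blast
  then obtain F where F: "finite F" "F \<subseteq> J" "J \<subseteq> lspan S F"
    using fg J by (auto simp: fg_submods_def)
  have "\<exists>N. F \<subseteq> lspan S (s ` {..<N})" using F(1,2)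
  proof (induction rule: finite_induct)
    case (insert f F)
    then obtain M N where "f \<in> lspan S (s ` {..<M})" "F \<subseteq> lspan S (s ` {..<N})"
      by (auto simp: J_def)
    then have "insert f F \<subseteq> lspan S (s ` {..<max M N})"
      by (auto intro: lspan_mono[OF image_mono, rotated])
    then show ?case by blast
  qed auto
  then obtain N where "F \<subseteq> lspan S (s ` {..<N})" by auto
  then have "J \<subseteq> lspan S (s ` {..<N})"
    using F(3) lspan_least[OF left_submod_lspan[OF S sc]] by blast
  moreover have "s N \<in> J"
    using lspan_superset[OF S sc, of "{..<Suc N}"] by (auto simp: J_def intro!: exI[of _ "Suc N"])
  ultimately show thesis using that by blast
qed

lemma fg_submods_field:
  assumes K: "subring K R" and inv: "\<And>a. a \<in> K \<Longrightarrow> a \<noteq> \<zero> \<Longrightarrow> \<exists>b\<in>K. b \<otimes> a = \<one>"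
  shows "fg_submods K"
  unfolding fg_submods_def
proof (intro allI impI)
  fix J assume J: "left_submod K J \<and> J \<subseteq> K"
  show "\<exists>F. finite F \<and> F \<subseteq> J \<and> J \<subseteq> lspan K F"
  proof (cases "J \<subseteq> {\<zero>}")
    case True
    then show ?thesis by (intro exI[of _ "{}"]) (auto intro: lspan.zero)
  next
    case False
    then obtain a b where a: "a \<in> J" "b \<in> K" "b \<otimes> a = \<one>" using J inv by blast
    have "v \<in> lspan K {a}" if v: "v \<in> J" for v
    proof -
      have "(v \<otimes> b) \<otimes> a \<oplus> \<zero> \<in> lspan K {a}"
        using v J a by (intro lspan.intros subringE(6)[OF K]) auto
      moreover have "(v \<otimes> b) \<otimes> a \<oplus> \<zero> = v"
        using v J a subringE(1)[OF K] by (auto simp: m_assoc subset_iff)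
      ultimately show ?thesis by simp
    qed
    then show ?thesis using a by (intro exI[of _ "{a}"]) auto
  qed
qed

text \<open>
  Left polynomials in \<open>x\<close> of degree less than \<open>d\<close>, with coefficients in \<open>S\<close> written on the left. The
  index is a strict bound so that \<open>0\<close> is the only polynomial at index \<open>0\<close>.
\<close>

fun poly_below :: "'a set \<Rightarrow> 'a \<Rightarrow> nat \<Rightarrow> 'a set" where
  "poly_below S x 0 = {\<zero>}"
| "poly_below S x (Suc d) = {p \<oplus> s \<otimes> x [^] d | p s. p \<in> poly_below S x d \<and> s \<in> S}"

end

section \<open>Hilbert's basis theorem for adjoining a derivation-like element\<close>

text \<open>
  The subring generated by \<open>S\<close> and \<open>x\<close> is a homomorphic image of the differential polynomial ring
  over \<open>S\<close> for the derivation \<open>s \<mapsto> x s - s x\<close>. The powers of \<open>x\<close> may be linearly dependent over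
  \<open>S\<close>; degrees are therefore upper bounds and never exact.
\<close>

locale skew_adjunction = ring +
  fixes S x
  assumes S: "subring S R" and x: "x \<in> carrier R"
    and comm: "\<And>s. s \<in> S \<Longrightarrow> x \<otimes> s \<ominus> s \<otimes> x \<in> S"
begin

lemma S_closed [simp]:
  "s \<in> S \<Longrightarrow> s \<in> carrier R" "\<zero> \<in> S" "\<one> \<in> S" "s \<in> S \<Longrightarrow> \<ominus> s \<in> S"
  "s \<in> S \<Longrightarrow> t \<in> S \<Longrightarrow> s \<otimes> t \<in> S" "s \<in> S \<Longrightarrow> t \<in> S \<Longrightarrow> s \<oplus> t \<in> S"
  using subringE[OF S] by auto

declare x [simp]

abbreviation P :: "nat \<Rightarrow> 'a set" where "P \<equiv> poly_below S x"

lemma P_Suc_iff: "q \<in> P (Suc d) \<longleftrightarrow> (\<exists>p\<in>P d. \<exists>s\<in>S. q = p \<oplus> s \<otimes> x [^] d)"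
  by auto

declare poly_below.simps(2) [simp del]

lemma P_closed [simp]: "p \<in> P d \<Longrightarrow> p \<in> carrier R"
  by (induction d arbitrary: p) (auto simp: P_Suc_iff)

lemma P_SucI: "p \<in> P d \<Longrightarrow> s \<in> S \<Longrightarrow> p \<oplus> s \<otimes> x [^] d \<in> P (Suc d)"
  unfolding P_Suc_iff by blast

lemma P_Suc: "p \<in> P d \<Longrightarrow> p \<in> P (Suc d)"
  using P_SucI[of p d \<zero>] by simp

lemma P_zero [simp]: "\<zero> \<in> P d"
  by (induction d) (simp_all add: P_Suc)

lemma P_monom: "s \<in> S \<Longrightarrow> s \<otimes> x [^] d \<in> P (Suc d)"
  using P_SucI[OF P_zero, of s d] by simp

lemma P_mono: "d \<le> e \<Longrightarrow> p \<in> P d \<Longrightarrow> p \<in> P e"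
  by (induction rule: dec_induct) (auto intro: P_Suc)

lemma P_add: "p \<in> P d \<Longrightarrow> q \<in> P d \<Longrightarrow> p \<oplus> q \<in> P d"
proof (induction d arbitrary: p q)
  case (Suc d)
  then obtain p' s q' t where *: "p' \<in> P d" "s \<in> S" "q' \<in> P d" "t \<in> S"
    "p = p' \<oplus> s \<otimes> x [^] d" "q = q' \<oplus> t \<otimes> x [^] d" unfolding P_Suc_iff by blast
  have "p \<oplus> q = (p' \<oplus> q') \<oplus> (s \<oplus> t) \<otimes> x [^] d"
    using * by (simp add: l_distr a_ac)
  then show ?case using P_SucI[OF Suc.IH[of p' q']] * by simp
qed auto

lemma P_smult: "p \<in> P d \<Longrightarrow> r \<in> S \<Longrightarrow> r \<otimes> p \<in> P d"
proof (induction d arbitrary: p)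
  case (Suc d)
  then obtain p' s where *: "p' \<in> P d" "s \<in> S" "p = p' \<oplus> s \<otimes> x [^] d"
    unfolding P_Suc_iff by blast
  have "r \<otimes> p = r \<otimes> p' \<oplus> (r \<otimes> s) \<otimes> x [^] d"
    using * Suc.prems by (simp add: r_distr m_assoc)
  then show ?case using P_SucI[OF Suc.IH[of p']] * Suc.prems by simp
qed auto

lemma P_minus: "p \<in> P d \<Longrightarrow> \<ominus> p \<in> P d"
  using P_smult[of p d "\<ominus> \<one>"] by (simp add: l_minus)

lemma P_diff: "p \<in> P d \<Longrightarrow> q \<in> P d \<Longrightarrow> p \<ominus> q \<in> P d"
  by (simp add: a_minus_def P_add P_minus)

lemma x_monom:
  assumes "s \<in> S"
  shows "x \<otimes> (s \<otimes> x [^] d) = (x \<otimes> s \<ominus> s \<otimes> x) \<otimes> x [^] d \<oplus> s \<otimes> x [^] Suc d"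
proof -
  have "x [^] Suc d = x \<otimes> x [^] d" using nat_pow_Suc2[OF x] by simp
  then show ?thesis using assms
    by (simp add: a_minus_def l_distr l_minus m_assoc a_assoc l_neg del: nat_pow_Suc)
qed

lemma x_P: "p \<in> P d \<Longrightarrow> x \<otimes> p \<in> P (Suc d)"
proof (induction d arbitrary: p)
  case 0 then show ?case by simp
next
  case (Suc d)
  then obtain p' s where *: "p' \<in> P d" "s \<in> S" "p = p' \<oplus> s \<otimes> x [^] d"
    unfolding P_Suc_iff by blast
  have "x \<otimes> p = (x \<otimes> p' \<oplus> (x \<otimes> s \<ominus> s \<otimes> x) \<otimes> x [^] d) \<oplus> s \<otimes> x [^] Suc d"
    using * comm[of s] by (simp add: r_distr x_monom a_assoc del: nat_pow_Suc)
  moreover have "x \<otimes> p' \<oplus> (x \<otimes> s \<ominus> s \<otimes> x) \<otimes> x [^] d \<in> P (Suc d)"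
    using * Suc.IH comm by (intro P_add P_monom) auto
  ultimately show ?case using * P_add P_monom P_Suc by metis
qed

lemma pow_P: "p \<in> P d \<Longrightarrow> x [^] k \<otimes> p \<in> P (d + k)"
proof (induction k)
  case (Suc k)
  have "x [^] Suc k \<otimes> p = x \<otimes> (x [^] k \<otimes> p)"
    using Suc.prems nat_pow_Suc2[OF x] by (simp add: m_assoc del: nat_pow_Suc)
  then show ?case using x_P[OF Suc.IH[OF Suc.prems]] by simp
qed simp

text \<open>
  Multiplication by a power of \<open>x\<close> shifts the leading coefficient without changing it, since the
  commutators that arise have lower degree.
\<close>

lemma pow_lead:
  assumes p: "p \<in> P d" and s: "s \<in> S"
  shows "x [^] k \<otimes> (p \<oplus> s \<otimes> x [^] d) \<ominus> s \<otimes> x [^] (d + k) \<in> P (d + k)"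
proof -
  have *: "x [^] k \<otimes> (s \<otimes> x [^] d) \<ominus> s \<otimes> x [^] (d + k) \<in> P (d + k)" for k
  proof (induction k)
    case 0 then show ?case using s by (simp add: a_minus_def r_neg)
  next
    case (Suc k)
    let ?u = "x [^] k \<otimes> (s \<otimes> x [^] d)" and ?v = "s \<otimes> x [^] (d + k)"
    have eq: "x [^] Suc k \<otimes> (s \<otimes> x [^] d) = x \<otimes> ?u"
      using s nat_pow_Suc2[OF x] by (simp add: m_assoc del: nat_pow_Suc)
    have "x \<otimes> ?u \<ominus> s \<otimes> x [^] (d + Suc k)
        = x \<otimes> (?u \<ominus> ?v) \<oplus> (x \<otimes> s \<ominus> s \<otimes> x) \<otimes> x [^] (d + k)"
    proof -
      have "x \<otimes> (?u \<ominus> ?v) = x \<otimes> ?u \<ominus> x \<otimes> ?v"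
        using s by (simp add: a_minus_def r_distr r_minus)
      then show ?thesis using s comm[of s]
        by (simp add: x_monom a_minus_def minus_add a_ac r_neg r_neg1 r_neg2 del: nat_pow_Suc)
    qed
    moreover have "\<dots> \<in> P (Suc (d + k))"
      using x_P[OF Suc.IH] P_monom[OF comm[OF s]] by (intro P_add) auto
    ultimately show ?case using eq by simp
  qed
  have "x [^] k \<otimes> (p \<oplus> s \<otimes> x [^] d) \<ominus> s \<otimes> x [^] (d + k)
      = x [^] k \<otimes> p \<oplus> (x [^] k \<otimes> (s \<otimes> x [^] d) \<ominus> s \<otimes> x [^] (d + k))"
    using p s by (simp add: a_minus_def r_distr a_assoc)
  then show ?thesis using *[of k] pow_P[OF p, of k] P_add by simp
qed

definition polys :: "'a set" where "polys = (\<Union>d. P d)"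

lemma S_subset_polys: "S \<subseteq> polys"
proof
  fix s assume "s \<in> S"
  then show "s \<in> polys" using P_monom[of s 0] using S_closed(1)[of s] by (auto simp: polys_def intro!: exI[of _ "Suc 0"])
qed

lemma x_in_polys: "x \<in> polys"
  using P_monom[of \<one> 1] unfolding polys_def by (intro UN_I[of "Suc 1"]) simp_all

lemma polys_mult: "p \<in> P d \<Longrightarrow> q \<in> P e \<Longrightarrow> p \<otimes> q \<in> P (d + e)"
proof (induction d arbitrary: p)
  case (Suc d)
  then obtain p' s where *: "p' \<in> P d" "s \<in> S" "p = p' \<oplus> s \<otimes> x [^] d"
    unfolding P_Suc_iff by blast
  have "p \<otimes> q = p' \<otimes> q \<oplus> s \<otimes> (x [^] d \<otimes> q)"
    using * Suc.prems by (simp add: l_distr m_assoc)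
  moreover have "p' \<otimes> q \<in> P (Suc d + e)" using Suc * by (auto intro: P_Suc)
  moreover have "s \<otimes> (x [^] d \<otimes> q) \<in> P (Suc d + e)"
    using P_smult[OF pow_P[OF Suc.prems(2)] *(2), of d] by (auto intro: P_Suc simp: add.commute)
  ultimately show ?case using P_add by simp
qed auto

lemma polys_subring: "subring polys R"
proof (rule subringI)
  show "polys \<subseteq> carrier R" by (auto simp: polys_def)
  show "\<one> \<in> polys" using S_subset_polys by auto
  show "\<ominus> h \<in> polys" if "h \<in> polys" for h using that P_minus by (auto simp: polys_def)
  show "g \<otimes> h \<in> polys" if "g \<in> polys" "h \<in> polys" for g h using that polys_mult by (fastforce simp: polys_def)
  show "g \<oplus> h \<in> polys" if "g \<in> polys" "h \<in> polys" for g h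
  proof -
    obtain d e where "g \<in> P d" "h \<in> P e" using \<open>g \<in> polys\<close> \<open>h \<in> polys\<close> by (auto simp: polys_def)
    then have "g \<in> P (max d e)" "h \<in> P (max d e)" by (auto elim: P_mono[rotated])
    then show ?thesis using P_add by (auto simp: polys_def)
  qed
qed

text \<open>
  A linear relation among leading coefficients lifts to an element of the left ideal with the
  corresponding leading term: multiply each \<open>f i\<close> by the power of \<open>x\<close> that brings it to degree \<open>M\<close>.
\<close>

lemma lspan_lead:
  assumes f: "\<And>i. i < N \<Longrightarrow> \<exists>p\<in>P (e i). f i = p \<oplus> s i \<otimes> x [^] e i"
    and s: "\<And>i. i < N \<Longrightarrow> s i \<in> S" and e: "\<And>i. i < N \<Longrightarrow> e i \<le> M"
    and v: "v \<in> lspan S (s ` {..<N})"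
  shows "\<exists>h\<in>lspan polys (f ` {..<N}). h \<ominus> v \<otimes> x [^] M \<in> P M"
proof -
  have sc: "s ` {..<N} \<subseteq> carrier R" using s by auto
  have vc: "v \<in> carrier R" if "v \<in> lspan S (s ` {..<N})" for v
    using left_submodD(1)[OF left_submod_lspan[OF S sc]] that by auto
  have fc: "f i \<in> carrier R" if "i < N" for i using f[OF that] s[OF that] by auto
  have hc: "h \<in> carrier R" if "h \<in> lspan polys (f ` {..<N})" for h
    using left_submodD(1)[OF left_submod_lspan[OF polys_subring, of "f ` {..<N}"]] that fc by auto
  show ?thesis using v
  proof induction
    case zero
    show ?case by (intro bexI[of _ \<zero>] lspan.zero) (simp add: a_minus_def)
  next
    case (add r g v)
    then obtain i where i: "i < N" "g = s i" by auto
    obtain p where p: "p \<in> P (e i)" "f i = p \<oplus> s i \<otimes> x [^] e i" using f i by blast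
    obtain h where h: "h \<in> lspan polys (f ` {..<N})" "h \<ominus> v \<otimes> x [^] M \<in> P M" using add.IH by blast
    define k where "k = M - e i"
    have M: "M = e i + k" using e[OF i(1)] by (simp add: k_def)
    have rT: "r \<otimes> x [^] k \<in> polys" using P_monom[OF add(1)] unfolding polys_def by blast
    let ?w = "x [^] k \<otimes> f i \<ominus> s i \<otimes> x [^] M"
    have w: "?w \<in> P M" using pow_lead[OF p(1) s[OF i(1)], of k] by (simp add: p(2) M)
    have "(r \<otimes> x [^] k) \<otimes> f i \<oplus> h \<ominus> (r \<otimes> g \<oplus> v) \<otimes> x [^] M
        = r \<otimes> ?w \<oplus> (h \<ominus> v \<otimes> x [^] M)"
      using i fc[OF i(1)] s[OF i(1)] hc[OF h(1)] vc[OF add(3)] add(1)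
      by (simp add: a_minus_def l_distr r_distr minus_add m_assoc r_minus a_ac)
    also have "\<dots> \<in> P M" using w h(2) add(1) by (intro P_add P_smult)
    finally show ?case using rT h(1) i by (intro bexI[OF _ lspan.add[OF rT _ h(1)]]) auto
  qed
qed

text \<open>
  The classical argument: if \<open>J\<close> were not finitely generated, one could choose \<open>f\<^sub>0, f\<^sub>1, \<dots>\<close>, each of
  least degree outside the span of its predecessors. Some leading coefficient lies in the span of
  the earlier ones, and subtracting the matching combination lowers the degree, against minimality.
\<close>

theorem fg_submods_polys:
  assumes fg: "fg_submods S"
  shows "fg_submods polys"
  unfolding fg_submods_def
proof (intro allI impI, rule ccontr)
  fix J assume J: "left_submod polys J \<and> J \<subseteq> polys"
    and nfg: "\<not> (\<exists>F. finite F \<and> F \<subseteq> J \<and> J \<subseteq> lspan polys F)"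
  define deg where "deg p = (LEAST d. p \<in> P d)" for p
  have deg: "p \<in> P (deg p)" if "p \<in> J" for p
  proof -
    have "p \<in> polys" using that J by blast
    then obtain d where "p \<in> P d" by (auto simp: polys_def)
    then show ?thesis unfolding deg_def by (rule LeastI)
  qed
  have deg_le: "deg p \<le> d" if "p \<in> P d" for p d
    using that unfolding deg_def by (rule Least_le)
  \<comment> \<open>The generators are chosen as a function of the finite set of earlier ones.\<close>
  define pick where "pick F = (ARG_MIN deg g. g \<in> J - lspan polys F)" for F
  have pick: "pick F \<in> J - lspan polys F" "\<And>g. g \<in> J - lspan polys F \<Longrightarrow> deg (pick F) \<le> deg g"
    if F: "finite F" "F \<subseteq> J" for F
  proof -
    obtain g where g: "g \<in> J - lspan polys F" using nfg F by blast
    show "pick F \<in> J - lspan polys F" unfolding pick_def by (rule arg_min_natI[of "\<lambda>g. g \<in> J - lspan polys F", OF g])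
    show "\<And>g. g \<in> J - lspan polys F \<Longrightarrow> deg (pick F) \<le> deg g"
      unfolding pick_def by (rule arg_min_nat_le)
  qed
  define H where "H = rec_nat {} (\<lambda>_ F. insert (pick F) F)"
  define f where "f n = pick (H n)" for n
  have H: "H n = f ` {..<n}" for n
    by (induction n) (auto simp: H_def f_def lessThan_Suc)
  have Hn: "finite (H n) \<and> H n \<subseteq> J" for n
  proof (induction n)
    case (Suc n)
    then show ?case using pick(1)[of "H n"] by (auto simp: H_def)
  qed (auto simp: H_def)
  have fJ: "f n \<in> J" and fnot: "f n \<notin> lspan polys (f ` {..<n})"
    and fmin: "\<And>g. g \<in> J \<Longrightarrow> g \<notin> lspan polys (f ` {..<n}) \<Longrightarrow> deg (f n) \<le> deg g" for n
    using pick[of "H n"] Hn[of n] unfolding f_def[symmetric] H[of n, symmetric] by auto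
  have mono: "deg (f i) \<le> deg (f n)" if "i \<le> n" for i n
  proof (rule fmin[OF fJ])
    show "f n \<notin> lspan polys (f ` {..<i})"
      using fnot[of n] lspan_mono[OF image_mono, of "{..<i}" "{..<n}" "f n" polys f] that by auto
  qed
  have "\<forall>n. \<exists>e p t. deg (f n) = Suc e \<and> p \<in> P e \<and> t \<in> S \<and> f n = p \<oplus> t \<otimes> x [^] e"
  proof
    fix n
    show "\<exists>e p t. deg (f n) = Suc e \<and> p \<in> P e \<and> t \<in> S \<and> f n = p \<oplus> t \<otimes> x [^] e"
    proof (cases "deg (f n)")
      case 0
      then have "f n = \<zero>" using deg[OF fJ[of n]] by simp
      then show ?thesis using fnot[of n] lspan.zero by auto
    next
      case (Suc e)
      then show ?thesis using deg[OF fJ[of n]] by (auto simp: P_Suc_iff)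
    qed
  qed
  from choice[OF this] obtain e where
    "\<forall>n. \<exists>p t. deg (f n) = Suc (e n) \<and> p \<in> P (e n) \<and> t \<in> S \<and> f n = p \<oplus> t \<otimes> x [^] e n"
    by (rule exE)
  from choice[OF this] obtain p where
    "\<forall>n. \<exists>t. deg (f n) = Suc (e n) \<and> p n \<in> P (e n) \<and> t \<in> S \<and> f n = p n \<oplus> t \<otimes> x [^] e n"
    by (rule exE)
  from choice[OF this] obtain t where
    "\<forall>n. deg (f n) = Suc (e n) \<and> p n \<in> P (e n) \<and> t n \<in> S \<and> f n = p n \<oplus> t n \<otimes> x [^] e n"
    by (rule exE)
  then have ept: "\<And>n. deg (f n) = Suc (e n)" "\<And>n. p n \<in> P (e n)"
    "\<And>n. t n \<in> S" "\<And>n. f n = p n \<oplus> t n \<otimes> x [^] e n" by blast+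
  obtain N where N: "t N \<in> lspan S (t ` {..<N})"
    by (rule fg_submods_sequence[OF S fg, of t]) (use ept(3) in auto)
  have e_le: "e i \<le> e N" if "i < N" for i using mono[of i N] that ept(1) by simp
  have "\<exists>h\<in>lspan polys (f ` {..<N}). h \<ominus> t N \<otimes> x [^] e N \<in> P (e N)"
  proof (rule lspan_lead[OF _ ept(3) e_le N])
    show "\<exists>q\<in>P (e i). f i = q \<oplus> t i \<otimes> x [^] e i" for i
      by (intro bexI[of _ "p i"] ept)
  qed
  then obtain h where h: "h \<in> lspan polys (f ` {..<N})" "h \<ominus> t N \<otimes> x [^] e N \<in> P (e N)"
    by (rule bexE)
  note JD = left_submodD[OF conjunct1[OF J]]
  have fc: "f ` A \<subseteq> carrier R" for A using fJ JD(1) by auto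
  note LD = left_submodD[OF left_submod_lspan[OF polys_subring fc]]
  have hJ: "h \<in> J" using lspan_least[OF conjunct1[OF J], of "f ` {..<N}"] h(1) fJ by auto
  have hc: "h \<in> carrier R" using hJ JD(1) by auto
  have pc: "p N \<in> carrier R" "t N \<in> carrier R" using P_closed[OF ept(2)] S_closed(1)[OF ept(3)] by simp_all
  let ?g = "f N \<ominus> h"
  have "?g = p N \<ominus> (h \<ominus> t N \<otimes> x [^] e N)"
    unfolding ept(4)[of N] using pc hc by (simp add: a_minus_def minus_add a_ac)
  then have "?g \<in> P (e N)" using P_diff[OF ept(2) h(2)] by simp
  then have "deg ?g < deg (f N)" using deg_le[of ?g "e N"] ept(1)[of N] by simp
  moreover have "?g \<in> J" using JD(3,4) fJ hJ by (simp add: a_minus_def)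
  moreover have "?g \<notin> lspan polys (f ` {..<N})"
  proof
    assume "?g \<in> lspan polys (f ` {..<N})"
    then have "?g \<oplus> h \<in> lspan polys (f ` {..<N})" using LD(3) h(1) by blast
    moreover have "?g \<oplus> h = f N" using hc fc[of UNIV]
      by (simp add: a_minus_def a_assoc l_neg image_subset_iff)
    ultimately show False using fnot by simp
  qed
  ultimately show False using fmin[of ?g N] by simp
qed


lemma polys_least:
  assumes H: "subring H R" "S \<subseteq> H" "x \<in> H" shows "polys \<subseteq> H"
proof -
  note HD = subringE[OF H(1)]
  have pow: "x [^] d \<in> H" for d :: nat by (induction d) (use HD H(3) in auto)
  have "P d \<subseteq> H" for d
    by (induction d) (use HD H(2) pow in \<open>auto simp: P_Suc_iff subset_iff\<close>)
  then show ?thesis by (auto simp: polys_def)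
qed

end

section \<open>Rings generated by a Heisenberg pair\<close>

context ring begin

lemma left_ideal_iff_left_submod: "left_ideal J R \<longleftrightarrow> left_submod (carrier R) J"
  by (simp add: left_ideal_def left_submod_def)

lemma left_noetherianI:
  assumes "fg_submods (carrier R)" shows "left_noetherian R"
  unfolding left_noetherian_def
proof (intro conjI allI impI)
  fix I assume "left_ideal I R"
  then have I: "left_submod (carrier R) I" by (simp add: left_ideal_iff_left_submod)
  then obtain F where F: "finite F" "F \<subseteq> I" "I \<subseteq> lspan (carrier R) F"
    using assms left_submodD(1)[OF I] by (auto simp: fg_submods_def)
  have "I \<subseteq> J" if "left_submod (carrier R) J" "F \<subseteq> J" for J
    using lspan_least[OF that] F(3) by blast
  then have "I = \<Inter>{J. left_ideal J R \<and> F \<subseteq> J}"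
    using I F(2) unfolding left_ideal_iff_left_submod by blast
  then show "\<exists>S. finite S \<and> S \<subseteq> carrier R \<and> I = \<Inter>{J. left_ideal J R \<and> S \<subseteq> J}"
    using F(1,2) left_submodD(1)[OF I] by blast
qed (rule ring_axioms)

text \<open>
  Commutation with \<open>u\<close> is a derivation. Whether it maps a subring into \<open>S\<close> can therefore be checked on
  generators.
\<close>

lemma subring_commutator_preimage:
  assumes S: "subring S R" and u: "u \<in> carrier R"
  shows "subring {s \<in> S. u \<otimes> s \<ominus> s \<otimes> u \<in> S} R" (is "subring ?H R")
proof -
  note SD = subringE[OF S]
  have car: "s \<in> carrier R" if "s \<in> S" for s using SD(1) that by blast
  show ?thesis
  proof (rule subringI)
    show "?H \<subseteq> carrier R" using car by auto
    show "\<one> \<in> ?H" using SD(2,3) u by (simp add: a_minus_def r_neg)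
  next
    fix h assume h: "h \<in> ?H"
    then have "u \<otimes> (\<ominus> h) \<ominus> (\<ominus> h) \<otimes> u = \<ominus> (u \<otimes> h \<ominus> h \<otimes> u)"
      using u car by (simp add: a_minus_def l_minus r_minus minus_add)
    then show "\<ominus> h \<in> ?H" using h SD(5) by simp
  next
    fix g h assume gh: "g \<in> ?H" "h \<in> ?H"
    then have *: "g \<in> carrier R" "h \<in> carrier R" using car by auto
    have "u \<otimes> (g \<oplus> h) \<ominus> (g \<oplus> h) \<otimes> u = (u \<otimes> g \<ominus> g \<otimes> u) \<oplus> (u \<otimes> h \<ominus> h \<otimes> u)"
      using u * by (simp add: a_minus_def l_distr r_distr minus_add a_ac)
    then show "g \<oplus> h \<in> ?H" using gh SD(7) by simp
    have "u \<otimes> (g \<otimes> h) \<ominus> (g \<otimes> h) \<otimes> u = (u \<otimes> g \<ominus> g \<otimes> u) \<otimes> h \<oplus> g \<otimes> (u \<otimes> h \<ominus> h \<otimes> u)"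
      using u * by (simp add: a_minus_def l_distr r_distr l_minus r_minus m_assoc a_assoc r_neg1)
    then show "g \<otimes> h \<in> ?H" using gh SD(6,7) by simp
  qed
qed

text \<open>
  The tower is \<open>K\<close>, \<open>K[z]\<close>, \<open>K[z][y]\<close> and finally everything. The commutators with the adjoined elements
  vanish on generators, except that \<open>x y - y x = z\<close>; this is why \<open>z\<close> has to be adjoined before \<open>y\<close>.
\<close>

theorem heisenberg_left_noetherian:
  assumes K: "subring K R" and inv: "\<And>a. a \<in> K \<Longrightarrow> a \<noteq> \<zero> \<Longrightarrow> \<exists>b\<in>K. b \<otimes> a = \<one>"
    and central: "\<And>a r. a \<in> K \<Longrightarrow> r \<in> carrier R \<Longrightarrow> a \<otimes> r = r \<otimes> a"
    and xyz: "x \<in> carrier R" "y \<in> carrier R" "z = x \<otimes> y \<ominus> y \<otimes> x"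
    and zx: "z \<otimes> x = x \<otimes> z" and zy: "z \<otimes> y = y \<otimes> z"
    and gen: "\<And>H. subring H R \<Longrightarrow> K \<subseteq> H \<Longrightarrow> x \<in> H \<Longrightarrow> y \<in> H \<Longrightarrow> carrier R \<subseteq> H"
  shows "left_noetherian R"
proof -
  have z: "z \<in> carrier R" using xyz by simp
  note KD = subringE[OF K]
  have comm: "u \<otimes> v \<ominus> v \<otimes> u \<in> H"
    if "subring H R" "u \<otimes> v = v \<otimes> u" "u \<in> carrier R" "v \<in> carrier R" for u v H
    using that subringE(2)[of H R] by (simp add: a_minus_def r_neg)
  have commK: "u \<otimes> a \<ominus> a \<otimes> u \<in> H" if "subring H R" "a \<in> K" "u \<in> carrier R" for a u H
    by (intro comm) (use that KD(1) central[of a u] in auto)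
  interpret Z: skew_adjunction R K z
    by (intro skew_adjunction.intro ring_axioms skew_adjunction_axioms.intro) (use K z commK[OF K] in auto)
  have "Z.polys \<subseteq> {s \<in> Z.polys. y \<otimes> s \<ominus> s \<otimes> y \<in> Z.polys}"
    by (rule Z.polys_least[OF subring_commutator_preimage[OF Z.polys_subring xyz(2)]])
      (use Z.S_subset_polys Z.x_in_polys xyz(2) commK[OF Z.polys_subring] comm[OF Z.polys_subring zy[symmetric] xyz(2) z] in auto)
  then interpret Y: skew_adjunction R Z.polys y
    by (intro skew_adjunction.intro ring_axioms skew_adjunction_axioms.intro)
      (use Z.polys_subring xyz(2) in auto)
  have "Z.polys \<subseteq> {s \<in> Y.polys. x \<otimes> s \<ominus> s \<otimes> x \<in> Y.polys}"
    by (rule Z.polys_least[OF subring_commutator_preimage[OF Y.polys_subring xyz(1)]])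
      (use Z.S_subset_polys Y.S_subset_polys Z.x_in_polys xyz(1) commK[OF Y.polys_subring]
        comm[OF Y.polys_subring zx[symmetric] xyz(1) z] in auto)
  then have "Y.polys \<subseteq> {s \<in> Y.polys. x \<otimes> s \<ominus> s \<otimes> x \<in> Y.polys}"
    by (rule Y.polys_least[OF subring_commutator_preimage[OF Y.polys_subring xyz(1)]])
      (use Y.S_subset_polys Y.x_in_polys Z.x_in_polys xyz(3) in auto)
  then interpret X: skew_adjunction R Y.polys x
    by (intro skew_adjunction.intro ring_axioms skew_adjunction_axioms.intro)
      (use Y.polys_subring xyz(1) in auto)
  have "carrier R \<subseteq> X.polys"
    by (rule gen[OF X.polys_subring])
      (use X.S_subset_polys Y.S_subset_polys Z.S_subset_polys X.x_in_polys Y.x_in_polys in auto)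
  then have "X.polys = carrier R" using subringE(1)[OF X.polys_subring] by blast
  moreover have "fg_submods X.polys"
    by (intro X.fg_submods_polys Y.fg_submods_polys Z.fg_submods_polys fg_submods_field K inv)
  ultimately show ?thesis by (intro left_noetherianI) simp
qed

end

definition opposite :: "('a, 'b) ring_scheme \<Rightarrow> ('a, 'b) ring_scheme" where
  "opposite R = R\<lparr>mult := \<lambda>x y. y \<otimes>\<^bsub>R\<^esub> x\<rparr>"

lemma opposite_simps [simp]:
  "carrier (opposite R) = carrier R" "add (opposite R) = add R" "zero (opposite R) = zero R"
  "one (opposite R) = one R" "x \<otimes>\<^bsub>opposite R\<^esub> y = y \<otimes>\<^bsub>R\<^esub> x" "a_inv (opposite R) = a_inv R"
  by (simp_all add: opposite_def a_inv_def[abs_def])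

lemma minus_opposite [simp]: "x \<ominus>\<^bsub>opposite R\<^esub> y = x \<ominus>\<^bsub>R\<^esub> y"
  by (simp add: a_minus_def)

lemma additive_subgroup_opposite: "additive_subgroup I (opposite R) \<longleftrightarrow> additive_subgroup I R"
  by (simp add: additive_subgroup_def opposite_def)

lemma ring_opposite:
  assumes "ring R" shows "ring (opposite R)"
proof -
  interpret ring R by fact
  have "abelian_group (opposite R)"
    using abelian_group_axioms
    by (simp add: abelian_group_def abelian_monoid_def abelian_group_axioms_def opposite_def)
  then show ?thesis
    by (intro ringI) (auto intro!: monoidI simp: m_assoc l_distr r_distr)
qed

lemma opposite_opposite [simp]: "opposite (opposite R) = R"
  by (simp add: opposite_def)

lemma subring_opposite:
  assumes "ring R" "subring H R" shows "subring H (opposite R)"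
  using subringE[OF assms(2)] by (intro ring.subringI[OF ring_opposite[OF assms(1)]]) auto

lemma right_noetherian_iff_opposite: 
  assumes "ring R"
  shows "right_noetherian R \<longleftrightarrow> left_noetherian (opposite R)"
  using assms ring_opposite[OF assms]
  by (simp add: right_noetherian_def left_noetherian_def right_ideal_def left_ideal_def
      additive_subgroup_opposite)

theorem heisenberg_noetherian:
  assumes R: "ring R" and K: "subring K R"
    and inv: "\<And>a. a \<in> K \<Longrightarrow> a \<noteq> \<zero>\<^bsub>R\<^esub> \<Longrightarrow> \<exists>b\<in>K. b \<otimes>\<^bsub>R\<^esub> a = \<one>\<^bsub>R\<^esub>"
    and central: "\<And>a r. a \<in> K \<Longrightarrow> r \<in> carrier R \<Longrightarrow> a \<otimes>\<^bsub>R\<^esub> r = r \<otimes>\<^bsub>R\<^esub> a"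
    and xyz: "x \<in> carrier R" "y \<in> carrier R" "z = x \<otimes>\<^bsub>R\<^esub> y \<ominus>\<^bsub>R\<^esub> y \<otimes>\<^bsub>R\<^esub> x"
    and zx: "z \<otimes>\<^bsub>R\<^esub> x = x \<otimes>\<^bsub>R\<^esub> z" and zy: "z \<otimes>\<^bsub>R\<^esub> y = y \<otimes>\<^bsub>R\<^esub> z"
    and gen: "\<And>H. subring H R \<Longrightarrow> K \<subseteq> H \<Longrightarrow> x \<in> H \<Longrightarrow> y \<in> H \<Longrightarrow> carrier R \<subseteq> H"
  shows "noetherian R"
proof -
  interpret ring R by fact
  have "left_noetherian R"
    using heisenberg_left_noetherian[OF K inv central xyz zx zy gen] by blast
  moreover have "left_noetherian (opposite R)"
  proof (rule ring.heisenberg_left_noetherian[OF ring_opposite[OF R] subring_opposite[OF R K],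
        where x = y and y = x and z = z])
    show "\<exists>b\<in>K. b \<otimes>\<^bsub>opposite R\<^esub> a = \<one>\<^bsub>opposite R\<^esub>" if "a \<in> K" "a \<noteq> \<zero>\<^bsub>opposite R\<^esub>" for a
      using inv[of a] central subringE(1)[OF K] that by (auto simp: subset_iff)
    show "carrier (opposite R) \<subseteq> H"
      if "subring H (opposite R)" "K \<subseteq> H" "y \<in> H" "x \<in> H" for H
      using gen[of H] subring_opposite[OF ring_opposite[OF R] that(1)] that by simp
    show "a \<otimes>\<^bsub>opposite R\<^esub> r = r \<otimes>\<^bsub>opposite R\<^esub> a" if "a \<in> K" "r \<in> carrier (opposite R)" for a r
      using central[of a r] that by simp
  qed (use xyz zx zy in auto)
  ultimately show ?thesis
    using right_noetherian_iff_opposite[OF R] by (simp add: noetherian_def)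
qed

section \<open>Quotients of nonassociative algebras\<close>

text \<open>
  The part of the algebra axioms that makes quotients by ideals well defined. It is weak enough to
  cover the free nonassociative algebra, the Lie algebras and the free associative algebra alike.
\<close>

locale bilinear_algebra = abelian_group A for A :: "('k::field, 'a) module" (structure) +
  assumes mult_closed [simp, intro]: "x \<in> carrier A \<Longrightarrow> y \<in> carrier A \<Longrightarrow> x \<otimes> y \<in> carrier A"
    and mult_l_distr: "x \<in> carrier A \<Longrightarrow> y \<in> carrier A \<Longrightarrow> z \<in> carrier A \<Longrightarrow>
      (x \<oplus> y) \<otimes> z = x \<otimes> z \<oplus> y \<otimes> z"
    and mult_r_distr: "x \<in> carrier A \<Longrightarrow> y \<in> carrier A \<Longrightarrow> z \<in> carrier A \<Longrightarrow>
      z \<otimes> (x \<oplus> y) = z \<otimes> x \<oplus> z \<otimes> y"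
    and smult_closed [simp, intro]: "x \<in> carrier A \<Longrightarrow> c \<odot> x \<in> carrier A"
    and smult_distr: "x \<in> carrier A \<Longrightarrow> y \<in> carrier A \<Longrightarrow> c \<odot> (x \<oplus> y) = c \<odot> x \<oplus> c \<odot> y"
begin

lemma alg_idealI:
  assumes "I \<subseteq> carrier A" "\<zero> \<in> I" "\<And>u v. u \<in> I \<Longrightarrow> v \<in> I \<Longrightarrow> u \<oplus> v \<in> I" "\<And>u. u \<in> I \<Longrightarrow> \<ominus> u \<in> I"
    "\<And>c u. u \<in> I \<Longrightarrow> c \<odot> u \<in> I"
    "\<And>x u. x \<in> carrier A \<Longrightarrow> u \<in> I \<Longrightarrow> x \<otimes> u \<in> I"
    "\<And>x u. x \<in> carrier A \<Longrightarrow> u \<in> I \<Longrightarrow> u \<otimes> x \<in> I"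
  shows "alg_ideal I A"
proof -
  have "additive_subgroup I A"
    using assms(1-4) by (intro additive_subgroupI add.subgroupI) auto
  then show ?thesis using assms by (auto simp: alg_ideal_def)
qed

lemma alg_idealD:
  assumes "alg_ideal I A"
  shows "I \<subseteq> carrier A" "\<zero> \<in> I" "u \<in> I \<Longrightarrow> v \<in> I \<Longrightarrow> u \<oplus> v \<in> I" "u \<in> I \<Longrightarrow> \<ominus> u \<in> I"
    "u \<in> I \<Longrightarrow> c \<odot> u \<in> I"
    "x \<in> carrier A \<Longrightarrow> u \<in> I \<Longrightarrow> x \<otimes> u \<in> I"
    "x \<in> carrier A \<Longrightarrow> u \<in> I \<Longrightarrow> u \<otimes> x \<in> I"
proof -
  interpret I: additive_subgroup I A using assms by (simp add: alg_ideal_def)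
  show "I \<subseteq> carrier A" "\<zero> \<in> I" "u \<in> I \<Longrightarrow> v \<in> I \<Longrightarrow> u \<oplus> v \<in> I" "u \<in> I \<Longrightarrow> \<ominus> u \<in> I"
    using I.a_subset by auto
qed (use assms in \<open>auto simp: alg_ideal_def\<close>)

lemma gen_alg_ideal_superset: "S \<subseteq> gen_alg_ideal A S"
  by (auto simp: gen_alg_ideal_def)

lemma gen_alg_ideal_least: "alg_ideal I A \<Longrightarrow> S \<subseteq> I \<Longrightarrow> gen_alg_ideal A S \<subseteq> I"
  by (auto simp: gen_alg_ideal_def)

lemma alg_ideal_gen_alg_ideal:
  assumes S: "S \<subseteq> carrier A"
  shows "alg_ideal (gen_alg_ideal A S) A"
proof (rule alg_idealI)
  have "alg_ideal (carrier A) A" by (rule alg_idealI) auto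
  then show "gen_alg_ideal A S \<subseteq> carrier A" using S by (auto simp: gen_alg_ideal_def)
qed (auto simp: gen_alg_ideal_def dest: alg_idealD)

end

locale algebra_quotient = bilinear_algebra +
  fixes I assumes ideal: "alg_ideal I A"
begin

sublocale abelian_subgroup I A
  using ideal abelian_group_axioms by (simp add: alg_ideal_def abelian_subgroupI3)

abbreviation Q where "Q \<equiv> alg_quot A I"

lemma coset_cases:
  assumes "X \<in> carrier Q" obtains x where "x \<in> carrier A" "X = I +> x"
  using assms by (auto simp: alg_quot_def A_RCOSETS_def')

lemma coset_closed [simp]: "x \<in> carrier A \<Longrightarrow> I +> x \<in> carrier Q"
  by (auto simp: alg_quot_def A_RCOSETS_def')

lemma coset_add [simp]:
  "x \<in> carrier A \<Longrightarrow> y \<in> carrier A \<Longrightarrow> (I +> x) \<oplus>\<^bsub>Q\<^esub> (I +> y) = I +> (x \<oplus> y)"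
  by (simp add: alg_quot_def a_rcos_sum)

lemma coset_eqI:
  assumes "h \<in> I" "x \<in> carrier A" shows "I +> (h \<oplus> x) = I +> x"
  using a_repr_independence'[of "h \<oplus> x" x] a_rcosI[OF assms(1) a_subset assms(2)] assms(2) by simp

lemma coset_memE:
  assumes "y \<in> I +> x" obtains h where "h \<in> I" "y = h \<oplus> x"
  using assms by (auto simp: a_r_coset_def')

lemma coset_mult [simp]:
  assumes x: "x \<in> carrier A" and y: "y \<in> carrier A"
  shows "(I +> x) \<otimes>\<^bsub>Q\<^esub> (I +> y) = I +> (x \<otimes> y)"
proof -
  note D = alg_idealD[OF ideal]
  have *: "I +> (a \<otimes> b) = I +> (x \<otimes> y)" if "a \<in> I +> x" "b \<in> I +> y" for a b
  proof -
    obtain h k where hk: "h \<in> I" "a = h \<oplus> x" "k \<in> I" "b = k \<oplus> y"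
      using \<open>a \<in> I +> x\<close> \<open>b \<in> I +> y\<close> by (auto elim!: coset_memE)
    have hkc: "h \<in> carrier A" "k \<in> carrier A" using hk D(1) by auto
    have "a \<otimes> b = (h \<otimes> k \<oplus> h \<otimes> y \<oplus> x \<otimes> k) \<oplus> x \<otimes> y"
      using hk hkc x y by (simp add: mult_l_distr mult_r_distr a_ac)
    moreover have "h \<otimes> k \<oplus> h \<otimes> y \<oplus> x \<otimes> k \<in> I"
      using hk hkc x y D by simp
    ultimately show ?thesis using coset_eqI x y by simp
  qed
  have "(\<Union>a\<in>I +> x. \<Union>b\<in>I +> y. I +> (a \<otimes> b)) = (\<Union>a\<in>I +> x. \<Union>b\<in>I +> y. I +> (x \<otimes> y))"
    by (intro SUP_cong refl *)
  also have "\<dots> = I +> (x \<otimes> y)" using a_rcos_self[OF x] a_rcos_self[OF y] by auto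
  finally show ?thesis by (simp add: alg_quot_def rcoset_mult_def)
qed

lemma coset_smult [simp]:
  assumes x: "x \<in> carrier A" shows "c \<odot>\<^bsub>Q\<^esub> (I +> x) = I +> (c \<odot> x)"
proof -
  note D = alg_idealD[OF ideal]
  have *: "I +> (c \<odot> a) = I +> (c \<odot> x)" if "a \<in> I +> x" for a
  proof -
    obtain h where h: "h \<in> I" "a = h \<oplus> x" using \<open>a \<in> I +> x\<close> by (rule coset_memE)
    then have "c \<odot> a = c \<odot> h \<oplus> c \<odot> x" using x D(1) by (auto simp: smult_distr)
    then show ?thesis using coset_eqI h D x by simp
  qed
  have "(\<Union>a\<in>I +> x. I +> (c \<odot> a)) = (\<Union>a\<in>I +> x. I +> (c \<odot> x))"
    by (intro SUP_cong refl *)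
  also have "\<dots> = I +> (c \<odot> x)" using a_rcos_self[OF x] by auto
  finally show ?thesis by (simp add: alg_quot_def)
qed

lemma zero_quot: "\<zero>\<^bsub>Q\<^esub> = I"
  by (simp add: alg_quot_def)

lemma coset_eq_zero: "x \<in> I \<Longrightarrow> I +> x = \<zero>\<^bsub>Q\<^esub>"
  using a_coset_join2[OF _ a_subgroup] a_subset by (auto simp: zero_quot)

lemma coset_zero: "I +> \<zero> = \<zero>\<^bsub>Q\<^esub>"
  by (rule coset_eq_zero) simp

lemma abelian_group_quot: "abelian_group Q"
proof (rule abelian_groupI)
  show "\<zero>\<^bsub>Q\<^esub> \<in> carrier Q" unfolding coset_zero[symmetric] by simp
  show "\<zero>\<^bsub>Q\<^esub> \<oplus>\<^bsub>Q\<^esub> X = X" if "X \<in> carrier Q" for X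
    using that unfolding coset_zero[symmetric] by (auto elim!: coset_cases)
  show "\<exists>Y\<in>carrier Q. Y \<oplus>\<^bsub>Q\<^esub> X = \<zero>\<^bsub>Q\<^esub>" if X: "X \<in> carrier Q" for X
  proof -
    obtain x where "x \<in> carrier A" "X = I +> x" using X by (rule coset_cases)
    then show ?thesis
      by (intro bexI[of _ "I +> (\<ominus> x)"]) (simp_all add: l_neg coset_zero)
  qed
qed (auto elim!: coset_cases simp: a_ac)

lemma bilinear_algebra_quot: "bilinear_algebra Q"
proof -
  interpret Q: abelian_group Q by (rule abelian_group_quot)
  show ?thesis
    by unfold_locales
      (auto elim!: coset_cases simp: mult_l_distr mult_r_distr smult_distr)
qed

lemma minus_coset: 
  assumes "x \<in> carrier A" shows "\<ominus>\<^bsub>Q\<^esub> (I +> x) = I +> (\<ominus> x)"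
proof -
  interpret Q: abelian_group Q by (rule abelian_group_quot)
  show ?thesis by (rule Q.minus_equality) (use assms in \<open>simp_all add: l_neg coset_zero\<close>)
qed

lemma coset_diff [simp]:
  "x \<in> carrier A \<Longrightarrow> y \<in> carrier A \<Longrightarrow> (I +> x) \<ominus>\<^bsub>Q\<^esub> (I +> y) = I +> (x \<ominus> y)"
  by (simp add: a_minus_def minus_coset)

end

section \<open>Homomorphisms and their factorisation\<close>

text \<open>
  Homomorphisms from an algebra given by a record to a whole type that carries a scalar
  multiplication \<open>sc\<close> and a product \<open>m\<close>. Total types as targets allow ordinary finite sums.
\<close>

definition algebra_map ::
    "('k::field, 'a) module \<Rightarrow> ('k \<Rightarrow> 'e \<Rightarrow> 'e) \<Rightarrow> ('e \<Rightarrow> 'e \<Rightarrow> 'e) \<Rightarrow> ('a \<Rightarrow> 'e::ab_group_add) \<Rightarrow> bool"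
  where "algebra_map A sc m f \<longleftrightarrow>
    (\<forall>x\<in>carrier A. \<forall>y\<in>carrier A. f (x \<oplus>\<^bsub>A\<^esub> y) = f x + f y \<and> f (x \<otimes>\<^bsub>A\<^esub> y) = m (f x) (f y)) \<and>
    (\<forall>c. \<forall>x\<in>carrier A. f (c \<odot>\<^bsub>A\<^esub> x) = sc c (f x))"

lemma algebra_mapD:
  assumes "algebra_map A sc m f" "x \<in> carrier A"
  shows "y \<in> carrier A \<Longrightarrow> f (x \<oplus>\<^bsub>A\<^esub> y) = f x + f y"
    "y \<in> carrier A \<Longrightarrow> f (x \<otimes>\<^bsub>A\<^esub> y) = m (f x) (f y)"
    "f (c \<odot>\<^bsub>A\<^esub> x) = sc c (f x)"
  using assms by (auto simp: algebra_map_def)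

locale bilinear_operations = vector_space sc
  for sc :: "'k::field \<Rightarrow> 'e::ab_group_add \<Rightarrow> 'e" +
  fixes m :: "'e \<Rightarrow> 'e \<Rightarrow> 'e"
  assumes m_add_left: "m (x + y) z = m x z + m y z"
    and m_add_right: "m z (x + y) = m z x + m z y"
    and m_scale_left: "m (sc c x) y = sc c (m x y)"
    and m_scale_right: "m x (sc c y) = sc c (m x y)"
begin

lemma m_zero [simp]: "m 0 y = 0" "m x 0 = 0"
  using m_add_left[of 0 0 y] m_add_right[of x 0 0] by auto

lemma algebra_map_zero_minus:
  assumes A: "bilinear_algebra A" and f: "algebra_map A sc m f"
  shows "f \<zero>\<^bsub>A\<^esub> = 0" "x \<in> carrier A \<Longrightarrow> f (\<ominus>\<^bsub>A\<^esub> x) = - f x"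
proof -
  interpret A: bilinear_algebra A by fact
  show zero: "f \<zero>\<^bsub>A\<^esub> = 0" using algebra_mapD(1)[OF f, of "\<zero>\<^bsub>A\<^esub>" "\<zero>\<^bsub>A\<^esub>"] by simp
  show "f (\<ominus>\<^bsub>A\<^esub> x) = - f x" if "x \<in> carrier A"
    using algebra_mapD(1)[OF f, of x "\<ominus>\<^bsub>A\<^esub> x"] that zero
    by (simp add: A.r_neg eq_neg_iff_add_eq_0 add.commute)
qed

lemma alg_ideal_kernel:
  assumes A: "bilinear_algebra A" and f: "algebra_map A sc m f"
  shows "alg_ideal {x \<in> carrier A. f x = 0} A"
proof -
  interpret A: bilinear_algebra A by fact
  show ?thesis
    by (rule A.alg_idealI)
      (auto simp: algebra_map_zero_minus[OF A f] algebra_mapD[OF f])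
qed

text \<open>
  The universal property of a quotient by a generated ideal: the kernel of \<open>f\<close> is an ideal, so it
  contains the ideal generated by \<open>S\<close>, and \<open>f\<close> is constant on cosets.
\<close>

lemma algebra_map_factor:
  assumes A: "bilinear_algebra A" and f: "algebra_map A sc m f"
    and S: "S \<subseteq> carrier A" "\<And>s. s \<in> S \<Longrightarrow> f s = 0"
  obtains g where "algebra_map (alg_quot A (gen_alg_ideal A S)) sc m g"
    "\<And>x. x \<in> carrier A \<Longrightarrow> g (gen_alg_ideal A S +>\<^bsub>A\<^esub> x) = f x"
proof -
  interpret A: bilinear_algebra A by fact
  let ?I = "gen_alg_ideal A S"
  interpret Q: algebra_quotient A ?I
    by unfold_locales (rule A.alg_ideal_gen_alg_ideal[OF S(1)])
  have ker: "f h = 0" if "h \<in> ?I" for h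
    using A.gen_alg_ideal_least[OF alg_ideal_kernel[OF A f], of S] S that by blast
  define g where "g X = f (SOME x. x \<in> X)" for X
  have g: "g (?I +>\<^bsub>A\<^esub> x) = f x" if x: "x \<in> carrier A" for x
  proof -
    have "(SOME y. y \<in> ?I +>\<^bsub>A\<^esub> x) \<in> ?I +>\<^bsub>A\<^esub> x"
      by (rule someI) (rule Q.a_rcos_self[OF x])
    then obtain h where "h \<in> ?I" "(SOME y. y \<in> ?I +>\<^bsub>A\<^esub> x) = h \<oplus>\<^bsub>A\<^esub> x"
      by (rule Q.coset_memE)
    then show ?thesis using x ker Q.a_subset
      by (auto simp: g_def algebra_mapD[OF f])
  qed
  have "algebra_map Q.Q sc m g"
    unfolding algebra_map_def
    by (auto elim!: Q.coset_cases simp: g algebra_mapD[OF f])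
  then show thesis using g that by blast
qed

lemma algebra_map_finsum:
  assumes A: "bilinear_algebra A" and f: "algebra_map A sc m f" and u: "u \<in> X \<rightarrow> carrier A"
    and fin: "finite X"
  shows "f (finsum A u X) = (\<Sum>i\<in>X. f (u i))"
proof -
  interpret A: bilinear_algebra A by fact
  show ?thesis using fin u
    by induction (auto simp: algebra_map_zero_minus[OF A f] algebra_mapD[OF f] Pi_def)
qed

end

section \<open>Free algebras\<close>

lemma keys_minus_subset: "Poly_Mapping.keys (p - q) \<subseteq> Poly_Mapping.keys p \<union> Poly_Mapping.keys (q :: 'b \<Rightarrow>\<^sub>0 'k::ab_group_add)"
  by (auto simp: in_keys_iff lookup_minus)

lemma keys_uminus: "Poly_Mapping.keys (- (q :: 'b \<Rightarrow>\<^sub>0 'k::ab_group_add)) = Poly_Mapping.keys q"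
  by (auto simp: in_keys_iff)

lemma poly_mapping_induct_on [consumes 1, case_names zero single add]:
  fixes p :: "'b \<Rightarrow>\<^sub>0 'k::comm_monoid_add"
  assumes p: "Poly_Mapping.keys p \<subseteq> B" and zero: "P 0"
    and single: "\<And>s c. s \<in> B \<Longrightarrow> P (Poly_Mapping.single s c)"
    and add: "\<And>p q. Poly_Mapping.keys p \<subseteq> B \<Longrightarrow> Poly_Mapping.keys q \<subseteq> B \<Longrightarrow> P p \<Longrightarrow> P q \<Longrightarrow> P (p + q)"
  shows "P p"
proof -
  have "finite A \<Longrightarrow> A \<subseteq> B \<Longrightarrow>
      P (\<Sum>s\<in>A. Poly_Mapping.single s (Poly_Mapping.lookup p s)) \<and>
      Poly_Mapping.keys (\<Sum>s\<in>A. Poly_Mapping.single s (Poly_Mapping.lookup p s)) \<subseteq> B" for A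
  proof (induction rule: finite_induct)
    case (insert s A)
    let ?q = "\<Sum>s\<in>A. Poly_Mapping.single s (Poly_Mapping.lookup p s)"
    let ?u = "Poly_Mapping.single s (Poly_Mapping.lookup p s)"
    have u: "Poly_Mapping.keys ?u \<subseteq> B" using insert by simp
    have "Poly_Mapping.keys (?u + ?q) \<subseteq> B" using Poly_Mapping.keys_add[of ?u ?q] u insert by blast
    then show ?case using add[of ?u ?q] single u insert by simp
  qed (simp add: zero)
  moreover have "(\<Sum>s\<in>Poly_Mapping.keys p. Poly_Mapping.single s (Poly_Mapping.lookup p s)) = p"
    by (rule poly_mapping_eqI) (simp add: lookup_sum lookup_single when_def in_keys_iff)
  ultimately show ?thesis using p by (metis finite_keys)
qed

text \<open>
  Identities between multi-additive expressions are checked on monomials one argument at a time;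
  associativity of the free algebra and multiplicativity of extended maps are both obtained so.
\<close>

lemma poly_mapping_additive_eqI:
  fixes F G :: "('b \<Rightarrow>\<^sub>0 'k::comm_monoid_add) \<Rightarrow> 'e::ab_group_add"
  assumes "\<And>p q. F (p + q) = F p + F q" "\<And>p q. G (p + q) = G p + G q"
    and "\<And>s c. F (Poly_Mapping.single s c) = G (Poly_Mapping.single s c)"
  shows "F p = G p"
proof -
  have "F 0 = 0" "G 0 = 0" using assms(1)[of 0 0] assms(2)[of 0 0] by simp_all
  with subset_UNIV show ?thesis
    by (induction p rule: poly_mapping_induct_on) (simp_all add: assms)
qed

text \<open>
  The coefficient is an argument of \<open>h\<close>, rather than a scalar multiplying a value of \<open>h\<close>, so that the
  same extension describes linear maps and the product of the free algebras.
\<close>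

definition additive_ext :: "('b \<Rightarrow> 'k::zero \<Rightarrow> 'e::comm_monoid_add) \<Rightarrow> ('b \<Rightarrow>\<^sub>0 'k) \<Rightarrow> 'e" where
  "additive_ext h p = (\<Sum>s\<in>Poly_Mapping.keys p. h s (Poly_Mapping.lookup p s))"

lemma additive_ext_superset:
  assumes "\<And>s. h s 0 = 0" "finite B" "Poly_Mapping.keys p \<subseteq> B"
  shows "additive_ext h p = (\<Sum>s\<in>B. h s (Poly_Mapping.lookup p s))"
  unfolding additive_ext_def
  by (rule sum.mono_neutral_left) (use assms in \<open>auto simp: in_keys_iff\<close>)

lemma additive_ext_single:
  "h s 0 = 0 \<Longrightarrow> additive_ext h (Poly_Mapping.single s c) = h s c"
  by (cases "c = 0") (simp_all add: additive_ext_def)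

lemma additive_ext_add:
  fixes h :: "'b \<Rightarrow> 'k::comm_monoid_add \<Rightarrow> 'e::comm_monoid_add"
  assumes zero: "\<And>s. h s 0 = 0" and add: "\<And>s a b. h s (a + b) = h s a + h s b"
  shows "additive_ext h (p + q) = additive_ext h p + additive_ext h q"
proof -
  let ?B = "Poly_Mapping.keys p \<union> Poly_Mapping.keys q"
  have "additive_ext h r = (\<Sum>s\<in>?B. h s (Poly_Mapping.lookup r s))"
    if "Poly_Mapping.keys r \<subseteq> ?B" for r
    by (rule additive_ext_superset) (use zero that in auto)
  then show ?thesis
    using Poly_Mapping.keys_add[of p q] by (simp add: lookup_add add sum.distrib)
qed

lemma bilinear_ext_alt:
  "bilinear_ext f p q =
     additive_ext (\<lambda>s a. additive_ext (\<lambda>t b. Poly_Mapping.single (f s t) (a * b)) q) p"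
  by (simp add: bilinear_ext_def additive_ext_def)

lemma bilinear_ext_single:
  "bilinear_ext f (Poly_Mapping.single s a) (Poly_Mapping.single t b) = Poly_Mapping.single (f s t) (a * b)"
  by (simp add: bilinear_ext_alt additive_ext_single)

lemma bilinear_ext_add_right: "bilinear_ext f p (q + r) = bilinear_ext f p q + bilinear_ext f p r"
  by (simp add: bilinear_ext_def[of f p] additive_ext_def[symmetric] additive_ext_add
      distrib_left single_add sum.distrib flip: additive_ext_def[of "\<lambda>t b. Poly_Mapping.single (f _ t) (_ * b)"])

lemma bilinear_ext_add_left: "bilinear_ext f (p + q) r = bilinear_ext f p r + bilinear_ext f q r"
  unfolding bilinear_ext_alt
  by (rule additive_ext_add)
    (simp_all add: additive_ext_def distrib_right single_add sum.distrib)

lemma lookup_map_scale: 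
  "Poly_Mapping.lookup (Poly_Mapping.map ((*) c) p) s = c * (Poly_Mapping.lookup p s :: 'k::field)"
  by (simp add: Poly_Mapping.map.rep_eq when_def)

lemma keys_map_scale: "Poly_Mapping.keys (Poly_Mapping.map ((*) (c::'k::field)) p) \<subseteq> Poly_Mapping.keys p"
  by (auto simp: in_keys_iff lookup_map_scale)

lemma map_scale_add:
  "Poly_Mapping.map ((*) (c::'k::field)) (p + q) = Poly_Mapping.map ((*) c) p + Poly_Mapping.map ((*) c) q"
  by (rule poly_mapping_eqI) (unfold lookup_map_scale lookup_add, rule distrib_left)

lemma keys_bilinear_ext:
  fixes p q :: "'b \<Rightarrow>\<^sub>0 'k::field"
  assumes "\<And>s t. s \<in> B \<Longrightarrow> t \<in> B \<Longrightarrow> f s t \<in> B"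
    and "Poly_Mapping.keys p \<subseteq> B" "Poly_Mapping.keys q \<subseteq> B"
  shows "Poly_Mapping.keys (bilinear_ext f p q) \<subseteq> B"
proof -
  have single: "Poly_Mapping.keys (Poly_Mapping.single (f s t) c) \<subseteq> B"
    if "s \<in> Poly_Mapping.keys p" "t \<in> Poly_Mapping.keys q" for s t and c :: 'k
    using that assms by auto
  have sum: "Poly_Mapping.keys (sum g K) \<subseteq> B"
    if "\<And>s. s \<in> K \<Longrightarrow> Poly_Mapping.keys (g s) \<subseteq> B" for g :: "'b \<Rightarrow> 'b \<Rightarrow>\<^sub>0 'k" and K
    using Poly_Mapping.keys_sum[of g K] that by blast
  show ?thesis unfolding bilinear_ext_def by (intro sum single)
qed

lemma magma_algebra_simps [simp]:
  "carrier (magma_algebra B f u) = {p. Poly_Mapping.keys p \<subseteq> B}"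
  "p \<otimes>\<^bsub>magma_algebra B f u\<^esub> q = bilinear_ext f p q"
  "\<one>\<^bsub>magma_algebra B f u\<^esub> = u"
  "\<zero>\<^bsub>magma_algebra B f u\<^esub> = 0"
  "p \<oplus>\<^bsub>magma_algebra B f u\<^esub> q = p + q"
  "c \<odot>\<^bsub>magma_algebra B f u\<^esub> p = Poly_Mapping.map ((*) c) p"
  by (simp_all add: magma_algebra_def)

lemma abelian_group_magma_algebra: "abelian_group (magma_algebra B f u)"
proof (rule abelian_groupI)
  fix p q assume "p \<in> carrier (magma_algebra B f u)" "q \<in> carrier (magma_algebra B f u)"
  then show "p \<oplus>\<^bsub>magma_algebra B f u\<^esub> q \<in> carrier (magma_algebra B f u)"
    using Poly_Mapping.keys_add[of p q] by auto
next
  fix p assume "p \<in> carrier (magma_algebra B f u)"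
  then show "\<exists>q\<in>carrier (magma_algebra B f u). q \<oplus>\<^bsub>magma_algebra B f u\<^esub> p = \<zero>\<^bsub>magma_algebra B f u\<^esub>"
    by (intro bexI[of _ "- p"]) (auto simp: keys_uminus)
qed (auto simp: add_ac)

lemma bilinear_algebra_magma_algebra:
  assumes "\<And>s t. s \<in> B \<Longrightarrow> t \<in> B \<Longrightarrow> f s t \<in> B"
  shows "bilinear_algebra (magma_algebra B f u)"
proof -
  interpret abelian_group "magma_algebra B f u" by (rule abelian_group_magma_algebra)
  show ?thesis
  proof unfold_locales
    fix p q assume "p \<in> carrier (magma_algebra B f u)" "q \<in> carrier (magma_algebra B f u)"
    then show "p \<otimes>\<^bsub>magma_algebra B f u\<^esub> q \<in> carrier (magma_algebra B f u)"
      using keys_bilinear_ext[OF assms] by simp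
  next
    fix p c assume "p \<in> carrier (magma_algebra B f u)"
    then show "c \<odot>\<^bsub>magma_algebra B f u\<^esub> p \<in> carrier (magma_algebra B f u)"
      using keys_map_scale[of c p] by auto
  qed (simp_all add: bilinear_ext_add_left bilinear_ext_add_right map_scale_add)
qed

lemma minus_magma_algebra:
  assumes "p \<in> carrier (magma_algebra B f u)" "q \<in> carrier (magma_algebra B f u)"
  shows "p \<ominus>\<^bsub>magma_algebra B f u\<^esub> q = p - q"
proof -
  interpret abelian_group "magma_algebra B f u" by (rule abelian_group_magma_algebra)
  have "\<ominus>\<^bsub>magma_algebra B f u\<^esub> q = - q"
    by (rule minus_equality) (use assms in \<open>simp_all add: keys_uminus\<close>)
  then show ?thesis by (simp add: a_minus_def)
qed

text \<open>
  The universal property of the free algebras: a map on basis elements that respects the operation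
  \<open>f\<close> extends linearly to a homomorphism.
\<close>

lemma (in bilinear_operations) algebra_map_magma_algebra:
  assumes g: "\<And>s t. g (f s t) = m (g s) (g t)"
  shows "algebra_map (magma_algebra B f u) sc m (additive_ext (\<lambda>s c. sc c (g s)))"
proof -
  let ?F = "additive_ext (\<lambda>s c. sc c (g s))"
  have add: "?F (p + q) = ?F p + ?F q" for p q
    by (rule additive_ext_add) (simp_all add: scale_left_distrib)
  have single: "?F (Poly_Mapping.single s c) = sc c (g s)" for s c
    by (simp add: additive_ext_single)
  have left: "?F (bilinear_ext f (Poly_Mapping.single s a) q) = m (?F (Poly_Mapping.single s a)) (?F q)" for s a q
    by (rule poly_mapping_additive_eqI)
      (simp_all add: add single bilinear_ext_add_right bilinear_ext_single m_add_right
        m_scale_left m_scale_right g mult.commute)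
  have mult: "?F (bilinear_ext f p q) = m (?F p) (?F q)" for p q
    by (rule poly_mapping_additive_eqI[where p = p])
      (simp_all add: left add bilinear_ext_add_left m_add_left)
  have "?F (Poly_Mapping.map ((*) c) p) = sc c (?F p)" for c p
    by (rule poly_mapping_additive_eqI)
      (simp_all add: add map_scale_add single scale_right_distrib)
  then show ?thesis using add mult by (simp add: algebra_map_def)
qed

lemma bilinear_algebra_free_na: "bilinear_algebra (free_na_algebra X)"
  unfolding free_na_algebra_def by (rule bilinear_algebra_magma_algebra) auto

lemma bilinear_algebra_free_assoc: "bilinear_algebra (free_assoc_algebra X)"
  unfolding free_assoc_algebra_def by (rule bilinear_algebra_magma_algebra) auto

lemma ring_free_assoc: "ring (free_assoc_algebra X :: ('k::field, 'x list \<Rightarrow>\<^sub>0 'k) module)"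
proof -
  let ?T = "free_assoc_algebra X :: ('k, 'x list \<Rightarrow>\<^sub>0 'k) module"
  interpret bilinear_algebra ?T by (rule bilinear_algebra_free_assoc)
  let ?m = "bilinear_ext (@) :: ('x list \<Rightarrow>\<^sub>0 'k) \<Rightarrow> _"
  note bi = bilinear_ext_add_left bilinear_ext_add_right bilinear_ext_single
  have 1: "?m (?m (Poly_Mapping.single s a) (Poly_Mapping.single t b)) r
      = ?m (Poly_Mapping.single s a) (?m (Poly_Mapping.single t b) r)" for s a t b r
    by (rule poly_mapping_additive_eqI[where p = r]) (simp_all add: bi mult.assoc)
  have 2: "?m (?m (Poly_Mapping.single s a) q) r = ?m (Poly_Mapping.single s a) (?m q r)" for s a q r
    by (rule poly_mapping_additive_eqI[where p = q])
      (simp_all only: bilinear_ext_add_left bilinear_ext_add_right 1)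
  have assoc: "?m (?m p q) r = ?m p (?m q r)" for p q r
    by (rule poly_mapping_additive_eqI[where p = p])
      (simp_all only: bilinear_ext_add_left bilinear_ext_add_right 2)
  have left: "?m (Poly_Mapping.single [] 1) p = p" and right: "?m p (Poly_Mapping.single [] 1) = p" for p
    by (rule poly_mapping_additive_eqI[where p = p], simp_all add: bi)+
  show ?thesis
  proof (intro ringI monoidI)
    show "abelian_group ?T" by (rule abelian_group_axioms)
  qed (auto simp: mult_l_distr mult_r_distr, auto simp: free_assoc_algebra_def assoc left right)
qed

section \<open>The universal enveloping algebra as a ring\<close>

text \<open>
  Generator indices occur in sets such as \<open>{1..n}\<close>, which should keep this form.
\<close>

declare One_nat_def [simp del]

locale enveloping = bilinear_algebra L for L :: "('k::field, 'a) module" (structure)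
begin

abbreviation T :: "('k, 'a list \<Rightarrow>\<^sub>0 'k) module" where "T \<equiv> free_assoc_algebra (carrier L)"
abbreviation J :: "('a list \<Rightarrow>\<^sub>0 'k) set" where "J \<equiv> gen_alg_ideal T (enveloping_relations L)"
abbreviation U :: "('k, ('a list \<Rightarrow>\<^sub>0 'k) set) module" where "U \<equiv> universal_enveloping L"

definition scal :: "'k \<Rightarrow> ('a list \<Rightarrow>\<^sub>0 'k) set" where
  "scal c = J +>\<^bsub>T\<^esub> Poly_Mapping.single [] c"

definition emb :: "'a \<Rightarrow> ('a list \<Rightarrow>\<^sub>0 'k) set" where
  "emb x = J +>\<^bsub>T\<^esub> Poly_Mapping.single [x] 1"

lemma carrier_T: "p \<in> carrier T \<longleftrightarrow> Poly_Mapping.keys p \<subseteq> lists (carrier L)"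
  by (simp add: free_assoc_algebra_def)

lemma T_add [simp]: "p \<oplus>\<^bsub>T\<^esub> q = p + q" and T_zero [simp]: "\<zero>\<^bsub>T\<^esub> = 0"
  and T_one: "\<one>\<^bsub>T\<^esub> = Poly_Mapping.single [] 1"
  by (simp_all add: free_assoc_algebra_def)

lemma T_mult: "p \<otimes>\<^bsub>T\<^esub> q = bilinear_ext (@) p q"
  by (simp add: free_assoc_algebra_def)

lemma T_diff: "p \<in> carrier T \<Longrightarrow> q \<in> carrier T \<Longrightarrow> p \<ominus>\<^bsub>T\<^esub> q = p - q"
  unfolding free_assoc_algebra_def by (rule minus_magma_algebra)

lemma single_T: "w \<in> lists (carrier L) \<Longrightarrow> Poly_Mapping.single w c \<in> carrier T"
  by (simp add: carrier_T)

lemma diff_T: "p \<in> carrier T \<Longrightarrow> q \<in> carrier T \<Longrightarrow> p - q \<in> carrier T"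
  using keys_minus_subset[of p q] by (auto simp: carrier_T)

lemma enveloping_relations_closed: "enveloping_relations L \<subseteq> carrier T"
  unfolding enveloping_relations_def Let_def by (auto intro!: diff_T single_T)

sublocale T: bilinear_algebra T by (rule bilinear_algebra_free_assoc)
sublocale T: ring T by (rule ring_free_assoc)

sublocale U: algebra_quotient T J
  rewrites "alg_quot T J = U"
  by (intro algebra_quotient.intro T.bilinear_algebra_axioms algebra_quotient_axioms.intro
      T.alg_ideal_gen_alg_ideal enveloping_relations_closed)
    (simp add: universal_enveloping_def)

lemma one_U: "\<one>\<^bsub>U\<^esub> = J +>\<^bsub>T\<^esub> \<one>\<^bsub>T\<^esub>"
  by (simp add: universal_enveloping_def alg_quot_def)

lemma ring_U: "ring U"
proof (intro ringI monoidI)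
  interpret V: bilinear_algebra U using U.bilinear_algebra_quot .
  show "abelian_group U" by (rule U.abelian_group_quot)
  show "x \<otimes>\<^bsub>U\<^esub> y \<in> carrier U" if "x \<in> carrier U" "y \<in> carrier U" for x y
    using that by (rule V.mult_closed)
  show "(x \<oplus>\<^bsub>U\<^esub> y) \<otimes>\<^bsub>U\<^esub> z = x \<otimes>\<^bsub>U\<^esub> z \<oplus>\<^bsub>U\<^esub> y \<otimes>\<^bsub>U\<^esub> z"
    if "x \<in> carrier U" "y \<in> carrier U" "z \<in> carrier U" for x y z
    using that by (rule V.mult_l_distr)
  show "z \<otimes>\<^bsub>U\<^esub> (x \<oplus>\<^bsub>U\<^esub> y) = z \<otimes>\<^bsub>U\<^esub> x \<oplus>\<^bsub>U\<^esub> z \<otimes>\<^bsub>U\<^esub> y"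
    if "x \<in> carrier U" "y \<in> carrier U" "z \<in> carrier U" for x y z
    using that by (rule V.mult_r_distr)
qed (auto elim!: U.coset_cases simp: one_U T.m_assoc simp del: T_add)

sublocale V: ring U by (rule ring_U)

lemma scal_closed [simp]: "scal c \<in> carrier U"
  unfolding scal_def by (intro U.coset_closed single_T) simp

lemma emb_closed [simp]: "x \<in> carrier L \<Longrightarrow> emb x \<in> carrier U"
  unfolding emb_def by (intro U.coset_closed single_T) simp

lemma scal_add: "scal (a + b) = scal a \<oplus>\<^bsub>U\<^esub> scal b"
  using U.coset_add[of "Poly_Mapping.single [] a" "Poly_Mapping.single [] b"]
  by (simp add: scal_def single_T single_add)

lemma scal_mult: "scal (a * b) = scal a \<otimes>\<^bsub>U\<^esub> scal b"
  using U.coset_mult[of "Poly_Mapping.single [] a" "Poly_Mapping.single [] b"]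
  by (simp add: scal_def single_T T_mult bilinear_ext_single)

lemma scal_one: "scal 1 = \<one>\<^bsub>U\<^esub>"
  by (simp add: scal_def one_U T_one)

lemma scal_zero: "scal 0 = \<zero>\<^bsub>U\<^esub>"
  using U.coset_zero by (simp add: scal_def)

lemma scal_central:
  assumes "X \<in> carrier U" shows "scal c \<otimes>\<^bsub>U\<^esub> X = X \<otimes>\<^bsub>U\<^esub> scal c"
proof -
  obtain p where p: "p \<in> carrier T" "X = J +>\<^bsub>T\<^esub> p" using assms by (rule U.coset_cases)
  have "bilinear_ext (@) (Poly_Mapping.single [] c) p = bilinear_ext (@) p (Poly_Mapping.single [] c)"
    by (rule poly_mapping_additive_eqI[where p = p])
      (simp_all add: bilinear_ext_add_left bilinear_ext_add_right bilinear_ext_single mult.commute)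
  then show ?thesis using p by (simp add: scal_def single_T T_mult)
qed

lemma coset_eq_of_diff:
  assumes "p - q \<in> J" "q \<in> carrier T" shows "J +>\<^bsub>T\<^esub> p = J +>\<^bsub>T\<^esub> q"
  using U.coset_eqI[OF assms] by simp

lemma relation_in_J: "r \<in> enveloping_relations L \<Longrightarrow> r \<in> J"
  using T.gen_alg_ideal_superset by blast

lemma emb_add:
  assumes "x \<in> carrier L" "y \<in> carrier L" shows "emb (x \<oplus> y) = emb x \<oplus>\<^bsub>U\<^esub> emb y"
proof -
  let ?s = "\<lambda>x. Poly_Mapping.single [x] 1 :: 'a list \<Rightarrow>\<^sub>0 'k"
  have "?s (x \<oplus> y) - ?s x - ?s y \<in> J"
    by (rule relation_in_J, unfold enveloping_relations_def Let_def) (use assms in blast)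
  then have "J +>\<^bsub>T\<^esub> ?s (x \<oplus> y) = J +>\<^bsub>T\<^esub> (?s x \<oplus>\<^bsub>T\<^esub> ?s y)"
    using assms by (intro coset_eq_of_diff T.a_closed single_T) (simp_all add: diff_diff_eq)
  then show ?thesis using assms by (simp add: emb_def single_T)
qed

lemma emb_smult:
  assumes "x \<in> carrier L" shows "emb (c \<odot> x) = scal c \<otimes>\<^bsub>U\<^esub> emb x"
proof -
  have "Poly_Mapping.single [c \<odot> x] 1 - Poly_Mapping.single [x] c \<in> J"
    by (rule relation_in_J, unfold enveloping_relations_def Let_def) (use assms in blast)
  then have "J +>\<^bsub>T\<^esub> Poly_Mapping.single [c \<odot> x] 1 = J +>\<^bsub>T\<^esub> Poly_Mapping.single [x] c"
    using assms by (intro coset_eq_of_diff single_T) simp_all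
  then show ?thesis using assms by (simp add: emb_def scal_def single_T T_mult bilinear_ext_single)
qed

lemma emb_bracket:
  assumes "x \<in> carrier L" "y \<in> carrier L"
  shows "emb (x \<otimes> y) = emb x \<otimes>\<^bsub>U\<^esub> emb y \<ominus>\<^bsub>U\<^esub> emb y \<otimes>\<^bsub>U\<^esub> emb x"
proof -
  let ?s = "\<lambda>w. Poly_Mapping.single w 1 :: 'a list \<Rightarrow>\<^sub>0 'k"
  have mem: "?s [x, y] \<in> carrier T" "?s [y, x] \<in> carrier T" "?s [x \<otimes> y] \<in> carrier T"
    using assms by (auto intro!: single_T)
  have "?s [x, y] - ?s [y, x] - ?s [x \<otimes> y] \<in> J"
    by (rule relation_in_J, unfold enveloping_relations_def Let_def) (use assms in blast)
  then have "J +>\<^bsub>T\<^esub> (?s [x, y] - ?s [y, x]) = J +>\<^bsub>T\<^esub> ?s [x \<otimes> y]"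
    using mem by (intro coset_eq_of_diff)
  moreover have "J +>\<^bsub>T\<^esub> (?s [x, y] \<ominus>\<^bsub>T\<^esub> ?s [y, x]) = (J +>\<^bsub>T\<^esub> ?s [x, y]) \<ominus>\<^bsub>U\<^esub> (J +>\<^bsub>T\<^esub> ?s [y, x])"
    using mem by (simp add: U.coset_diff)
  moreover have "emb x \<otimes>\<^bsub>U\<^esub> emb y = J +>\<^bsub>T\<^esub> ?s [x, y]" "emb y \<otimes>\<^bsub>U\<^esub> emb x = J +>\<^bsub>T\<^esub> ?s [y, x]"
    using assms by (simp_all add: emb_def single_T T_mult bilinear_ext_single)
  ultimately show ?thesis using mem by (simp add: T_diff emb_def)
qed

lemma emb_zero: "emb \<zero> = \<zero>\<^bsub>U\<^esub>"
  using emb_add[of \<zero> \<zero>] V.add.r_cancel_one[of "emb \<zero>" "emb \<zero>"] by simp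

text \<open>
  A word is the product of its letters, so the letters and the scalars generate the ring.
\<close>

lemma subring_generated:
  assumes H: "subring H U" and scal: "range scal \<subseteq> H" and emb: "emb ` carrier L \<subseteq> H"
  shows "carrier U \<subseteq> H"
proof
  fix X assume "X \<in> carrier U"
  then obtain p where p: "p \<in> carrier T" "X = J +>\<^bsub>T\<^esub> p" by (rule U.coset_cases)
  note HD = subringE[OF H]
  have word: "J +>\<^bsub>T\<^esub> Poly_Mapping.single w c \<in> H" if "w \<in> lists (carrier L)" for w c
    using that
  proof (induction w)
    case Nil
    then show ?case using scal by (auto simp: scal_def)
  next
    case (Cons x w)
    then have "J +>\<^bsub>T\<^esub> Poly_Mapping.single (x # w) c = emb x \<otimes>\<^bsub>U\<^esub> (J +>\<^bsub>T\<^esub> Poly_Mapping.single w c)"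
      by (simp add: emb_def single_T T_mult bilinear_ext_single)
    then show ?case using Cons emb HD(6) by auto
  qed
  have "J +>\<^bsub>T\<^esub> p \<in> H" using p(1)[unfolded carrier_T]
  proof (induction p rule: poly_mapping_induct_on)
    case zero
    show ?case using U.coset_zero HD(2) by simp
  next
    case (single w c)
    then show ?case by (rule word)
  next
    case (add p q)
    then have "J +>\<^bsub>T\<^esub> (p + q) = (J +>\<^bsub>T\<^esub> p) \<oplus>\<^bsub>U\<^esub> (J +>\<^bsub>T\<^esub> q)"
      using U.coset_add[of p q] by (simp add: carrier_T)
    then show ?case using add HD(7) by simp
  qed
  then show "X \<in> H" using p by simp
qed

lemma subring_range_scal: "subring (range scal) U"
proof (rule V.subringI)
  fix a assume "a \<in> range scal"
  then obtain c where c: "a = scal c" by auto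
  have "\<ominus>\<^bsub>U\<^esub> scal c = scal (- c)"
    by (rule V.minus_equality) (simp_all flip: scal_add add: scal_zero)
  then show "\<ominus>\<^bsub>U\<^esub> a \<in> range scal" by (simp add: c)
qed (auto simp flip: scal_add scal_mult scal_one)

end


section \<open>The Lie Yang-Mills algebra\<close>

lemma (in bilinear_algebra) lie_axiom_elements_closed: "lie_axiom_elements A \<subseteq> carrier A"
  by (auto simp: lie_axiom_elements_def)

lemma algebra_quotient_free_lie: "algebra_quotient (free_na_algebra X) (free_lie_ideal X)"
  unfolding free_lie_ideal_def
  using bilinear_algebra_free_na[of X]
  by (intro algebra_quotient.intro algebra_quotient_axioms.intro
      bilinear_algebra.alg_ideal_gen_alg_ideal bilinear_algebra.lie_axiom_elements_closed)

lemma bilinear_algebra_free_lie: "bilinear_algebra (free_lie X)"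
  unfolding free_lie_def
  by (rule algebra_quotient.bilinear_algebra_quot[OF algebra_quotient_free_lie])

lemma single_free_na: "set_magma t \<subseteq> X \<Longrightarrow> Poly_Mapping.single t c \<in> carrier (free_na_algebra X)"
  by (simp add: free_na_algebra_def)

lemma free_lie_gen_closed: "i \<in> X \<Longrightarrow> free_lie_gen X i \<in> carrier (free_lie X)"
  unfolding free_lie_gen_def free_lie_def
  by (intro algebra_quotient.coset_closed[OF algebra_quotient_free_lie] single_free_na) simp

lemma ym_relations_closed:
  "ym_relations n \<subseteq> carrier (free_lie {1..n} :: ('k::field, (nat magma \<Rightarrow>\<^sub>0 'k) set) module)"
proof -
  interpret L: bilinear_algebra "free_lie {1..n} :: ('k, (nat magma \<Rightarrow>\<^sub>0 'k) set) module" by (rule bilinear_algebra_free_lie)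
  show ?thesis unfolding ym_relations_def Let_def
    by (safe intro!: L.finsum_closed L.mult_closed free_lie_gen_closed)
qed

lemma algebra_quotient_lie_yang_mills:
  "algebra_quotient (free_lie {1..n}) (gen_alg_ideal (free_lie {1..n}) (ym_relations n))"
  using bilinear_algebra_free_lie
  by (intro algebra_quotient.intro algebra_quotient_axioms.intro
      bilinear_algebra.alg_ideal_gen_alg_ideal ym_relations_closed)

lemma bilinear_algebra_lie_yang_mills: "bilinear_algebra (lie_yang_mills k n)"
  unfolding lie_yang_mills_def
  by (rule algebra_quotient.bilinear_algebra_quot[OF algebra_quotient_lie_yang_mills])

definition ym_gen :: "nat \<Rightarrow> nat \<Rightarrow> (nat magma \<Rightarrow>\<^sub>0 'k::field) set set" where
  "ym_gen n i = gen_alg_ideal (free_lie {1..n}) (ym_relations n) +>\<^bsub>free_lie {1..n}\<^esub> free_lie_gen {1..n} i"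

lemma ym_gen_closed: "i \<in> {1..n} \<Longrightarrow> ym_gen n i \<in> carrier (lie_yang_mills k n)"
  unfolding ym_gen_def lie_yang_mills_def
  by (intro algebra_quotient.coset_closed[OF algebra_quotient_lie_yang_mills] free_lie_gen_closed)

text \<open>
  Every element is the class of a combination of bracketings of the generators.
\<close>

lemma lie_yang_mills_generated:
  fixes k :: "'k::field itself"
  assumes sum: "\<And>x y. x \<in> G \<Longrightarrow> y \<in> G \<Longrightarrow> x \<oplus>\<^bsub>lie_yang_mills k n\<^esub> y \<in> G"
    and mult: "\<And>x y. x \<in> G \<Longrightarrow> y \<in> G \<Longrightarrow> x \<otimes>\<^bsub>lie_yang_mills k n\<^esub> y \<in> G"
    and smult: "\<And>c x. x \<in> G \<Longrightarrow> c \<odot>\<^bsub>lie_yang_mills k n\<^esub> x \<in> G"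
    and zero_mem: "\<zero>\<^bsub>lie_yang_mills k n\<^esub> \<in> G"
    and gen: "\<And>i. i \<in> {1..n} \<Longrightarrow> ym_gen n i \<in> G"
  shows "carrier (lie_yang_mills k n) \<subseteq> G"
proof
  let ?F = "free_na_algebra {1..n} :: ('k, nat magma \<Rightarrow>\<^sub>0 'k) module"
  let ?N = "gen_alg_ideal (free_lie {1..n}) (ym_relations n) :: (nat magma \<Rightarrow>\<^sub>0 'k) set set"
  interpret A: algebra_quotient ?F "free_lie_ideal {1..n}"
    rewrites "alg_quot ?F (free_lie_ideal {1..n}) = free_lie {1..n}"
    by (rule algebra_quotient_free_lie) (simp add: free_lie_def)
  interpret B: algebra_quotient "free_lie {1..n} :: ('k, _) module" ?N
    rewrites "alg_quot (free_lie {1..n}) ?N = lie_yang_mills k n"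
    by (rule algebra_quotient_lie_yang_mills) (simp add: lie_yang_mills_def)
  define q where "q p = ?N +>\<^bsub>free_lie {1..n}\<^esub> (free_lie_ideal {1..n} +>\<^bsub>?F\<^esub> p)" for p
  have F_ops: "p \<oplus>\<^bsub>?F\<^esub> r = p + r" "p \<otimes>\<^bsub>?F\<^esub> r = bilinear_ext Br p r"
    "c \<odot>\<^bsub>?F\<^esub> p = Poly_Mapping.map ((*) c) p" "\<zero>\<^bsub>?F\<^esub> = 0" for p r c
    by (simp_all add: free_na_algebra_def)
  have q_add: "q (p + r) = q p \<oplus>\<^bsub>lie_yang_mills k n\<^esub> q r"
    if "p \<in> carrier ?F" "r \<in> carrier ?F" for p r
    using that by (simp add: q_def flip: F_ops)
  have q_mult: "q (bilinear_ext Br p r) = q p \<otimes>\<^bsub>lie_yang_mills k n\<^esub> q r"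
    if "p \<in> carrier ?F" "r \<in> carrier ?F" for p r
    using that by (simp add: q_def flip: F_ops)
  have q_smult: "q (Poly_Mapping.map ((*) c) p) = c \<odot>\<^bsub>lie_yang_mills k n\<^esub> q p"
    if "p \<in> carrier ?F" for p c
    using that by (simp add: q_def flip: F_ops)
  have q_zero: "q 0 = \<zero>\<^bsub>lie_yang_mills k n\<^esub>"
    by (simp add: q_def A.coset_zero B.coset_zero flip: F_ops)
  have mon: "q (Poly_Mapping.single t 1) \<in> G" if "set_magma t \<subseteq> {1..n}" for t
    using that
  proof (induction t)
    case (Gen i)
    then show ?case using gen[of i] by (simp add: q_def ym_gen_def free_lie_gen_def)
  next
    case (Br s t)
    then show ?case
      using q_mult[of "Poly_Mapping.single s 1" "Poly_Mapping.single t 1"] mult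
      by (simp add: bilinear_ext_single single_free_na)
  qed
  fix X assume "X \<in> carrier (lie_yang_mills k n)"
  then obtain Y where "Y \<in> carrier (free_lie {1..n})" "X = ?N +>\<^bsub>free_lie {1..n}\<^esub> Y"
    by (rule B.coset_cases)
  then obtain p where p: "p \<in> carrier ?F" "X = q p"
    using A.coset_cases[of Y thesis] by (auto simp: q_def)
  have "Poly_Mapping.keys p \<subseteq> {t. set_magma t \<subseteq> {1..n}}"
    using p(1) by (simp add: free_na_algebra_def)
  then have "q p \<in> G"
  proof (induction p rule: poly_mapping_induct_on)
    case zero
    show ?case using zero_mem by (simp add: q_zero)
  next
    case (single t c)
    then show ?case
      using q_smult[of "Poly_Mapping.single t 1" c] smult[OF mon[of t], of c]
      by (simp add: single_free_na)
  next
    case (add p r)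
    then have "p \<in> carrier ?F" "r \<in> carrier ?F" by (simp_all add: free_na_algebra_def)
    then show ?case using add q_add sum by simp
  qed
  then show "X \<in> G" using p by simp
qed

lemma (in abelian_group) finsum_1_2:
  "g 1 \<in> carrier G \<Longrightarrow> g 2 \<in> carrier G \<Longrightarrow> finsum G g {1..2::nat} = g 1 \<oplus> g 2"
proof -
  have "{1..2} = {1, 2::nat}" by auto
  then show "g 1 \<in> carrier G \<Longrightarrow> g 2 \<in> carrier G \<Longrightarrow> finsum G g {1..2::nat} = g 1 \<oplus> g 2"
    by simp
qed

lemma ym_relation:
  fixes k :: "'k::field itself"
  assumes "j \<in> {1..2}"
  shows "ym_gen 2 1 \<otimes>\<^bsub>lie_yang_mills k 2\<^esub> (ym_gen 2 1 \<otimes>\<^bsub>lie_yang_mills k 2\<^esub> ym_gen 2 j)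
    \<oplus>\<^bsub>lie_yang_mills k 2\<^esub> ym_gen 2 2 \<otimes>\<^bsub>lie_yang_mills k 2\<^esub> (ym_gen 2 2 \<otimes>\<^bsub>lie_yang_mills k 2\<^esub> ym_gen 2 j)
    = \<zero>\<^bsub>lie_yang_mills k 2\<^esub>"
proof -
  let ?L = "free_lie {1..2} :: ('k, (nat magma \<Rightarrow>\<^sub>0 'k) set) module"
  let ?N = "gen_alg_ideal ?L (ym_relations 2)" and ?x = "free_lie_gen {1..2}"
  interpret B: algebra_quotient ?L ?N
    rewrites "alg_quot ?L ?N = lie_yang_mills k 2"
    by (rule algebra_quotient_lie_yang_mills) (simp add: lie_yang_mills_def)
  have x: "?x i \<in> carrier ?L" if "i \<in> {1..2}" for i using that by (rule free_lie_gen_closed)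
  have x12: "?x 1 \<in> carrier ?L" "?x 2 \<in> carrier ?L" by (auto intro!: x)
  let ?r = "finsum ?L (\<lambda>i. ?x i \<otimes>\<^bsub>?L\<^esub> (?x i \<otimes>\<^bsub>?L\<^esub> ?x j)) {1..2}"
  have "?r \<in> ?N"
    using assms by (intro subsetD[OF B.gen_alg_ideal_superset]) (auto simp: ym_relations_def Let_def)
  moreover have "?r = ?x 1 \<otimes>\<^bsub>?L\<^esub> (?x 1 \<otimes>\<^bsub>?L\<^esub> ?x j) \<oplus>\<^bsub>?L\<^esub> ?x 2 \<otimes>\<^bsub>?L\<^esub> (?x 2 \<otimes>\<^bsub>?L\<^esub> ?x j)"
    using x12 x[OF assms] by (simp add: B.finsum_1_2)
  ultimately show ?thesis
    using x12 x[OF assms] B.coset_eq_zero[of ?r] by (simp add: ym_gen_def)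
qed

section \<open>Two generators: the noetherian case\<close>

text \<open>
  With the diagonal terms gone, the relations for \<open>j = 2\<close> and \<open>j = 1\<close> read \<open>[x, [x, y]] = 0\<close> and
  \<open>[y, [y, x]] = 0\<close>. The elements of the Lie algebra whose images lie in a given subring form a Lie
  subalgebra, since subrings are closed under commutators; hence \<open>x\<close> and \<open>y\<close> generate the ring over
  the scalars.
\<close>

theorem noetherian_yang_mills_2: "noetherian (yang_mills (k :: 'k::field itself) 2)"
proof -
  let ?L = "lie_yang_mills k 2"
  interpret enveloping ?L by (intro enveloping.intro bilinear_algebra_lie_yang_mills)
  define x where "x = emb (ym_gen 2 1)"
  define y where "y = emb (ym_gen 2 2)"
  define z where "z = x \<otimes>\<^bsub>U\<^esub> y \<ominus>\<^bsub>U\<^esub> y \<otimes>\<^bsub>U\<^esub> x"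
  let ?br = "\<lambda>a b. a \<otimes>\<^bsub>U\<^esub> b \<ominus>\<^bsub>U\<^esub> b \<otimes>\<^bsub>U\<^esub> a"
  have gens: "ym_gen 2 1 \<in> carrier ?L" "ym_gen 2 2 \<in> carrier ?L"
    by (auto intro!: ym_gen_closed)
  have xy: "x \<in> carrier U" "y \<in> carrier U" "z \<in> carrier U" using gens by (auto simp: x_def y_def z_def)
  have brr: "?br a a = \<zero>\<^bsub>U\<^esub>" if "a \<in> carrier U" for a
    using that by (simp add: a_minus_def V.r_neg)
  have br0: "?br a \<zero>\<^bsub>U\<^esub> = \<zero>\<^bsub>U\<^esub>" if "a \<in> carrier U" for a
    using that by (simp add: a_minus_def)
  have br00: "\<zero>\<^bsub>U\<^esub> \<ominus>\<^bsub>U\<^esub> \<zero>\<^bsub>U\<^esub> = \<zero>\<^bsub>U\<^esub>" by (simp add: a_minus_def)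
  have "emb (ym_gen 2 1 \<otimes>\<^bsub>?L\<^esub> (ym_gen 2 1 \<otimes>\<^bsub>?L\<^esub> ym_gen 2 j)
      \<oplus>\<^bsub>?L\<^esub> ym_gen 2 2 \<otimes>\<^bsub>?L\<^esub> (ym_gen 2 2 \<otimes>\<^bsub>?L\<^esub> ym_gen 2 j)) = \<zero>\<^bsub>U\<^esub>" if "j \<in> {1..2}" for j
    using ym_relation[OF that, of k] emb_zero by simp
  from this[of 1] this[of 2] have rel: "?br y (?br y x) = \<zero>\<^bsub>U\<^esub>" "?br x (?br x y) = \<zero>\<^bsub>U\<^esub>"
    using gens xy by (simp_all add: emb_add emb_bracket brr br0 br00 flip: x_def y_def)
  have "?br y x = \<ominus>\<^bsub>U\<^esub> z" using xy by (simp add: z_def a_minus_def V.minus_add V.a_comm)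
  then have zy: "z \<otimes>\<^bsub>U\<^esub> y = y \<otimes>\<^bsub>U\<^esub> z"
    using rel(1) xy V.minus_minus[of "z \<otimes>\<^bsub>U\<^esub> y"] V.minus_minus[of "y \<otimes>\<^bsub>U\<^esub> z"]
    by (simp add: V.l_minus V.r_minus)
  have zx: "z \<otimes>\<^bsub>U\<^esub> x = x \<otimes>\<^bsub>U\<^esub> z" using rel(2) xy by (simp flip: z_def)
  have "noetherian U"
  proof (rule heisenberg_noetherian[OF ring_U subring_range_scal _ _ xy(1,2) z_def zx zy])
    show "\<exists>b\<in>range scal. b \<otimes>\<^bsub>U\<^esub> a = \<one>\<^bsub>U\<^esub>" if "a \<in> range scal" "a \<noteq> \<zero>\<^bsub>U\<^esub>" for a
    proof -
      obtain c where c: "a = scal c" using \<open>a \<in> range scal\<close> by auto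
      then have "c \<noteq> 0" using that scal_zero by auto
      then have "scal (inverse c) \<otimes>\<^bsub>U\<^esub> a = \<one>\<^bsub>U\<^esub>" by (simp add: c flip: scal_mult scal_one)
      then show ?thesis by blast
    qed
    show "a \<otimes>\<^bsub>U\<^esub> r = r \<otimes>\<^bsub>U\<^esub> a" if "a \<in> range scal" "r \<in> carrier U" for a r
      using that scal_central by auto
    fix H assume H: "subring H U" "range scal \<subseteq> H" "x \<in> H" "y \<in> H"
    note HD = subringE[OF H(1)]
    let ?G = "{l \<in> carrier ?L. emb l \<in> H}"
    have "carrier ?L \<subseteq> ?G"
    proof (rule lie_yang_mills_generated)
      fix a b assume "a \<in> ?G" "b \<in> ?G"
      then show "a \<oplus>\<^bsub>?L\<^esub> b \<in> ?G" "a \<otimes>\<^bsub>?L\<^esub> b \<in> ?G"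
        using HD(5-7) by (simp_all add: emb_add emb_bracket a_minus_def)
    next
      fix a c assume "a \<in> ?G"
      moreover have "scal c \<in> H" using H(2) by auto
      ultimately show "c \<odot>\<^bsub>?L\<^esub> a \<in> ?G" using HD(6) by (simp add: emb_smult)
    next
      show "\<zero>\<^bsub>?L\<^esub> \<in> ?G" using HD(2) by (simp add: emb_zero)
    next
      fix i :: nat assume "i \<in> {1..2}"
      then have "i = 1 \<or> i = 2" by auto
      then show "ym_gen 2 i \<in> ?G" using gens H(3,4) by (auto simp: x_def y_def)
    qed
    then show "carrier U \<subseteq> H" by (intro subring_generated H) auto
  qed
  then show ?thesis by (simp add: yang_mills_def)
qed

section \<open>Universal properties\<close>

locale lie_operations = bilinear_operations sc br
  for sc :: "'k::field \<Rightarrow> 'e::ab_group_add \<Rightarrow> 'e" and br +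
  assumes br_self: "br x x = 0"
    and jacobi: "br x (br y z) + br y (br z x) + br z (br x y) = 0"
begin

lemma free_lie_universal:
  fixes g :: "'x \<Rightarrow> 'e"
  obtains f where "algebra_map (free_lie X) sc br f" "\<And>i. i \<in> X \<Longrightarrow> f (free_lie_gen X i) = g i"
proof -
  let ?F = "free_na_algebra X :: ('k, 'x magma \<Rightarrow>\<^sub>0 'k) module"
  interpret F: bilinear_algebra ?F by (rule bilinear_algebra_free_na)
  define ev where "ev = rec_magma g (\<lambda>_ _. br)"
  let ?f = "additive_ext (\<lambda>t c. sc c (ev t))"
  have map: "algebra_map ?F sc br ?f"
    unfolding free_na_algebra_def by (rule algebra_map_magma_algebra) (simp add: ev_def)
  note D = algebra_mapD[OF map]
  have "?f s = 0" if "s \<in> lie_axiom_elements ?F" for s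
    using that by (auto simp: lie_axiom_elements_def D br_self jacobi)
  then obtain h where "algebra_map (free_lie X) sc br h"
    and h: "\<And>x. x \<in> carrier ?F \<Longrightarrow> h (free_lie_ideal X +>\<^bsub>?F\<^esub> x) = ?f x"
    using algebra_map_factor[OF F.bilinear_algebra_axioms map F.lie_axiom_elements_closed]
    unfolding free_lie_def free_lie_ideal_def by metis
  moreover have "h (free_lie_gen X i) = g i" if "i \<in> X" for i
    using h[of "Poly_Mapping.single (Gen i) 1"] that
    by (simp add: free_lie_gen_def single_free_na additive_ext_single ev_def)
  ultimately show thesis using that by blast
qed

lemma lie_yang_mills_universal:
  fixes g :: "nat \<Rightarrow> 'e" and k :: "'k itself"
  assumes rel: "\<And>j. j \<in> {1..n} \<Longrightarrow> (\<Sum>i\<in>{1..n}. br (g i) (br (g i) (g j))) = 0"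
  obtains f where "algebra_map (lie_yang_mills k n) sc br f"
    "\<And>i. i \<in> {1..n} \<Longrightarrow> f (ym_gen n i) = g i"
proof -
  let ?L = "free_lie {1..n} :: ('k, (nat magma \<Rightarrow>\<^sub>0 'k) set) module" and ?x = "free_lie_gen {1..n}"
  interpret L: bilinear_algebra ?L by (rule bilinear_algebra_free_lie)
  obtain f where f: "algebra_map ?L sc br f" "\<And>i. i \<in> {1..n} \<Longrightarrow> f (?x i) = g i"
    using free_lie_universal[of "{1..n}" g] by blast
  note D = algebra_mapD[OF f(1)]
  have x: "?x i \<in> carrier ?L" if "i \<in> {1..n}" for i using that by (rule free_lie_gen_closed)
  have "f r = 0" if "r \<in> ym_relations n" for r
  proof -
    obtain j where j: "j \<in> {1..n}"
      and r: "r = finsum ?L (\<lambda>i. ?x i \<otimes>\<^bsub>?L\<^esub> (?x i \<otimes>\<^bsub>?L\<^esub> ?x j)) {1..n}"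
      using \<open>r \<in> ym_relations n\<close> unfolding ym_relations_def Let_def by blast
    have "f r = (\<Sum>i\<in>{1..n}. f (?x i \<otimes>\<^bsub>?L\<^esub> (?x i \<otimes>\<^bsub>?L\<^esub> ?x j)))"
      unfolding r by (intro algebra_map_finsum L.bilinear_algebra_axioms f(1) Pi_I L.mult_closed x j) auto
    also have "\<dots> = (\<Sum>i\<in>{1..n}. br (g i) (br (g i) (g j)))"
      by (rule sum.cong[OF refl]) (simp only: D x j f(2) L.mult_closed)
    finally show ?thesis using rel[OF j] by simp
  qed
  then obtain h where "algebra_map (lie_yang_mills k n) sc br h"
    and h: "\<And>x. x \<in> carrier ?L \<Longrightarrow> h (gen_alg_ideal ?L (ym_relations n) +>\<^bsub>?L\<^esub> x) = f x"
    using algebra_map_factor[OF L.bilinear_algebra_axioms f(1) ym_relations_closed]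
    unfolding lie_yang_mills_def by metis
  moreover have "h (ym_gen n i) = g i" if "i \<in> {1..n}" for i
    using h[OF x[OF that]] f(2)[OF that] by (simp add: ym_gen_def)
  ultimately show thesis using that by blast
qed

end

locale associative_operations = bilinear_operations sc m
  for sc :: "'k::field \<Rightarrow> 'e::ab_group_add \<Rightarrow> 'e" and m +
  fixes e :: 'e
  assumes m_assoc: "m (m x y) z = m x (m y z)"
    and m_unit [simp]: "m e x = x" "m x e = x"
begin

abbreviation commutator :: "'e \<Rightarrow> 'e \<Rightarrow> 'e" where "commutator x y \<equiv> m x y - m y x"

lemma m_diff: "m (x - y) z = m x z - m y z" "m z (x - y) = m z x - m z y"
  using m_add_left[of "x - y" y z] m_add_right[of z "x - y" y] by (simp_all add: algebra_simps)

sublocale lie: lie_operations sc commutator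
proof
  show "commutator x (commutator y z) + commutator y (commutator z x) + commutator z (commutator x y) = 0"
    for x y z by (simp add: m_diff m_assoc)
qed (simp_all add: m_add_left m_add_right m_scale_left m_scale_right scale_right_diff_distrib)

text \<open>
  A word goes to the product of the images of its letters; the relations of the enveloping algebra
  say that this is linear in each letter and turns brackets into commutators.
\<close>

lemma enveloping_universal:
  assumes L: "enveloping L" and \<phi>: "algebra_map L sc commutator \<phi>"
  obtains \<psi> where "algebra_map (universal_enveloping L) sc m \<psi>"
    "\<And>x. x \<in> carrier L \<Longrightarrow> \<psi> (enveloping.emb L x) = \<phi> x"
proof -
  interpret enveloping L by fact
  define word where "word w = foldr (\<lambda>x. m (\<phi> x)) w e" for w
  have word_append: "word (u @ v) = m (word u) (word v)" for u v
    by (induction u) (simp_all add: word_def m_assoc)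
  let ?f = "additive_ext (\<lambda>w c. sc c (word w))"
  have add: "?f (p + q) = ?f p + ?f q" for p q
    by (rule additive_ext_add) (simp_all add: scale_left_distrib)
  have diff: "?f (p - q) = ?f p - ?f q" for p q
    using add[of "p - q" q] by simp
  have single: "?f (Poly_Mapping.single w c) = sc c (word w)" for w c
    by (simp add: additive_ext_single)
  have map: "algebra_map T sc m ?f"
    unfolding free_assoc_algebra_def by (rule algebra_map_magma_algebra) (simp add: word_append)
  have w: "word [x] = \<phi> x" "word [x, y] = m (\<phi> x) (\<phi> y)" for x y
    by (simp_all add: word_def)
  have "?f r = 0" if "r \<in> enveloping_relations L" for r
    using that unfolding enveloping_relations_def Let_def
    by (auto simp: diff single w algebra_mapD[OF \<phi>])
  then obtain \<psi> where "algebra_map U sc m \<psi>" and \<psi>: "\<And>p. p \<in> carrier T \<Longrightarrow> \<psi> (J +>\<^bsub>T\<^esub> p) = ?f p"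
    using algebra_map_factor[OF T.bilinear_algebra_axioms map enveloping_relations_closed]
    unfolding universal_enveloping_def by metis
  moreover have "\<psi> (emb x) = \<phi> x" if "x \<in> carrier L" for x
    using \<psi>[OF single_T[of "[x]" 1]] that by (simp add: emb_def single w)
  ultimately show thesis using that by blast
qed

end

section \<open>Three or more generators: the non-noetherian case\<close>

text \<open>
  The triple \<open>(p, n, q)\<close> is the upper triangular matrix with diagonal entries \<open>p\<close>, \<open>q\<close> and upper right
  entry \<open>n\<close>. Keeping \<open>p\<close> in the field is what makes the upper right corner large as a left ideal.
\<close>

fun tri_scale :: "'k::field \<Rightarrow> 'k \<times> 'k poly \<times> 'k poly \<Rightarrow> 'k \<times> 'k poly \<times> 'k poly" where
  "tri_scale c (p, n, q) = (c * p, Polynomial.smult c n, Polynomial.smult c q)"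

fun tri_mult :: "'k::field \<times> 'k poly \<times> 'k poly \<Rightarrow> 'k \<times> 'k poly \<times> 'k poly \<Rightarrow> 'k \<times> 'k poly \<times> 'k poly"
  where "tri_mult (p, n, q) (p', n', q') = (p * p', Polynomial.smult p n' + n * q', q * q')"

interpretation tri: associative_operations tri_scale tri_mult "(1, 0, 1)"
  by unfold_locales (auto simp: algebra_simps smult_add_left smult_add_right)

text \<open>
  The left ideal of all \<open>u\<close> with \<open>\<psi> u = (0, n, 0)\<close> is the union of those with \<open>n\<close> of degree less
  than \<open>d\<close>; these are left ideals because only scalars act on \<open>n\<close>. Finitely many elements lie in a
  single one of them, and \<open>B A\<^sup>d\<close> lies outside it.
\<close>

lemma not_left_noetherian_if_tri_map:
  assumes R: "ring R" and \<psi>: "algebra_map R tri_scale tri_mult \<psi>"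
    and A: "A \<in> carrier R" "\<psi> A = (0, 0, Polynomial.monom 1 1)" and B: "B \<in> carrier R" "\<psi> B = (0, 1, 0)"
  shows "\<not> left_noetherian R"
proof
  assume "left_noetherian R"
  interpret ring R by fact
  note D = algebra_mapD[OF \<psi>]
  have zero: "\<psi> \<zero>\<^bsub>R\<^esub> = 0" using D(1)[of "\<zero>\<^bsub>R\<^esub>" "\<zero>\<^bsub>R\<^esub>"] by simp
  have neg: "\<psi> (\<ominus>\<^bsub>R\<^esub> u) = - \<psi> u" if "u \<in> carrier R" for u
    using D(1)[of u "\<ominus>\<^bsub>R\<^esub> u"] that zero by (simp add: r_neg eq_neg_iff_add_eq_0 add.commute)
  define N where "N M = {u \<in> carrier R. \<exists>n. \<psi> u = (0, n, 0) \<and> (\<forall>i\<in>M. Polynomial.coeff n i = 0)}" for M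
  have ideal: "left_ideal (N M) R" for M
    unfolding left_ideal_def
  proof (intro conjI additive_subgroup_carrierI ballI)
    show "N M \<subseteq> carrier R" by (auto simp: N_def)
    show "\<zero>\<^bsub>R\<^esub> \<in> N M" by (auto simp: N_def zero zero_prod_def)
    show "u \<oplus>\<^bsub>R\<^esub> v \<in> N M" if "u \<in> N M" "v \<in> N M" for u v
      using that by (auto simp: N_def D)
    show "\<ominus>\<^bsub>R\<^esub> u \<in> N M" if "u \<in> N M" for u
      using that by (auto simp: N_def neg)
    show "r \<otimes>\<^bsub>R\<^esub> u \<in> N M" if "r \<in> carrier R" "u \<in> N M" for r u
      using that by (cases "\<psi> r") (auto simp: N_def D)
  qed
  obtain S where S: "finite S" "N {} = \<Inter>{J. left_ideal J R \<and> S \<subseteq> J}"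
    using \<open>left_noetherian R\<close> ideal[of "{}"] unfolding left_noetherian_def by blast
  have "S \<subseteq> N {}" using S(2) by blast
  define deg where "deg u = Polynomial.degree (fst (snd (\<psi> u)))" for u
  obtain d where d: "\<forall>u\<in>S. deg u < d"
    using finite_nat_set_iff_bounded[of "deg ` S"] S(1) by auto
  have "S \<subseteq> N {d..}"
  proof
    fix u assume "u \<in> S"
    then have "u \<in> N {}" "deg u < d" using \<open>S \<subseteq> N {}\<close> d by auto
    then show "u \<in> N {d..}" by (auto simp: N_def deg_def intro!: coeff_eq_0)
  qed
  then have sub: "N {} \<subseteq> N {d..}" using S(2) ideal by blast
  \<comment> \<open>\<open>u i\<close> is \<open>B A\<^sup>i\<close>, built from \<open>B\<close> so that \<open>\<psi>\<close> is evaluated on products of \<open>A\<close> and \<open>B\<close> alone.\<close>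
  define u where "u = rec_nat B (\<lambda>_ v. v \<otimes>\<^bsub>R\<^esub> A)"
  have "u i \<in> carrier R \<and> \<psi> (u i) = (0, Polynomial.monom 1 i, 0)" for i
    by (induction i) (use A B in \<open>simp_all add: u_def D mult_monom One_nat_def\<close>)
  then have "u d \<in> N {}" "u d \<notin> N {d..}" by (auto simp: N_def)
  then show False using sub by blast
qed

text \<open>
  The images of \<open>x\<^sub>1\<close> and \<open>x\<^sub>2\<close> are proportional with factor a square root of \<open>-1\<close>, so their double
  brackets cancel in every relation; the double bracket with the image of \<open>x\<^sub>3\<close> vanishes on all the
  images.
\<close>

theorem not_left_noetherian_yang_mills:
  assumes n: "n \<ge> 3"
  shows "\<not> left_noetherian (yang_mills (k :: 'k::alg_closed_field itself) n)"
proof -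
  let ?L = "lie_yang_mills k n"
  interpret enveloping ?L by (intro enveloping.intro bilinear_algebra_lie_yang_mills)
  obtain i :: 'k where i: "i ^ 2 = - 1" using nth_root_exists[of 2 "- 1 :: 'k"] by auto
  define g :: "nat \<Rightarrow> 'k \<times> 'k poly \<times> 'k poly" where
    "g j = (if j = 1 then (0, 0, Polynomial.monom 1 1) else if j = 2 then (0, 0, Polynomial.monom i 1)
      else if j = 3 then (0, 1, 0) else 0)" for j
  have "(\<Sum>l\<in>{1..n}. tri.commutator (g l) (tri.commutator (g l) (g j))) = 0" for j
  proof -
    have "(\<Sum>l\<in>{1..n}. tri.commutator (g l) (tri.commutator (g l) (g j)))
        = (\<Sum>l\<in>{1, 2, 3}. tri.commutator (g l) (tri.commutator (g l) (g j)))"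
      by (rule sum.mono_neutral_right) (use n in \<open>auto simp: g_def\<close>)
    also have "\<dots> = 0"
    proof -
      have "Polynomial.monom i 1 * Polynomial.monom i 1 = - (Polynomial.monom 1 1 * Polynomial.monom 1 1)"
        using i by (simp add: mult_monom power2_eq_square minus_monom)
      then show ?thesis
        by (cases "j = 1"; cases "j = 2"; cases "j = 3")
          (simp_all add: g_def zero_prod_def mult.commute)
    qed
    finally show ?thesis .
  qed
  then obtain \<phi> where \<phi>: "algebra_map ?L tri_scale tri.commutator \<phi>"
    "\<And>j. j \<in> {1..n} \<Longrightarrow> \<phi> (ym_gen n j) = g j"
    using tri.lie.lie_yang_mills_universal[of n g k] by blast
  obtain \<psi> where \<psi>: "algebra_map U tri_scale tri_mult \<psi>"
    "\<And>x. x \<in> carrier ?L \<Longrightarrow> \<psi> (emb x) = \<phi> x"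
    using tri.enveloping_universal[OF enveloping_axioms \<phi>(1)] by blast
  have gens: "ym_gen n 1 \<in> carrier ?L" "ym_gen n 3 \<in> carrier ?L"
    using n by (auto intro!: ym_gen_closed)
  show ?thesis unfolding yang_mills_def
  proof (rule not_left_noetherian_if_tri_map[OF ring_U \<psi>(1)])
    show "emb (ym_gen n 1) \<in> carrier U" "emb (ym_gen n 3) \<in> carrier U"
      using gens by (auto intro: emb_closed)
    show "\<psi> (emb (ym_gen n 1)) = (0, 0, Polynomial.monom 1 1)" "\<psi> (emb (ym_gen n 3)) = (0, 1, 0)"
      using n by (simp_all add: \<psi>(2) gens \<phi>(2) g_def del: One_nat_def)
  qed
qed

theorem mainTheorem6:
  fixes n :: nat
  assumes "n \<ge> 2"
  shows "noetherian (yang_mills TYPE('k::{alg_closed_field, field_char_0}) n) \<longleftrightarrow> n = 2"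
proof
  assume "noetherian (yang_mills TYPE('k) n)"
  then have "\<not> n \<ge> 3" using not_left_noetherian_yang_mills by (auto simp: noetherian_def)
  then show "n = 2" using assms by simp
qed (use noetherian_yang_mills_2 in blast)

end
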